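(* Let $(R,S,\pi,\cdot)$ be a crossed module of shelves and $\Bbbk$ a field. One has category inclusions $$\mathcal M_{\mathbf{Set}}(R,S)\hookrightarrow\mathcal{YD}_S^R,\qquad \mathcal M_{\Bbbk}(R,S)\hookrightarrow\mathcal{YD}_{\Bbbk S}^{\Bbbk R},$$ obtained by keeping the $S$-action and interpreting the $R$-grading as the coaction $m\mapsto m\otimes gr(m)$, respectively $m\mapsto\sum_{r\in R}m_r\otimes r$.
   Context: A shelf is a set with a binary operation $\lhd$ satisfying $(a\lhd b)\lhd c=(a\lhd c)\lhd(b\lhd c)$. An $S$-module in sets (resp. $\Bbbk$-vector spaces) is a set (resp. vector space) $M$ with $\blacktriangleleft\colon M\times S\to M$ (linear in $M$) satisfying $(m\blacktriangleleft s)\blacktriangleleft s'=(m\blacktriangleleft s')\blacktriangleleft(s\lhd s')$. A crossed module of shelves $(R,S,\pi,\cdot)$: shelves $R,S$, a shelf morphism $\pi\colon R\to S$, and an $S$-module structure $\cdot$ on the set $R$ by shelf morphisms, with $r\cdot\pi(r')=r\lhd r'$, $\pi(r\cdot s)=\pi(r)\lhd s$. $\mathcal M_{\mathbf{Set}}(R,S)$ (resp. $\mathcal M_{\Bbbk}(R,S)$): the category of representations, i.e. $S$-modules $M$ in sets (resp. vector spaces) with an $R$-grading ($gr\colon M\to R$, $M_r=gr^{-1}(r)$; resp. $M=\bigoplus_rM_r$) such that $M_r\blacktriangleleft s\subseteq M_{r\cdot s}$; morphisms are (linear) maps preserving action and grading. $\mathcal{YD}_S^R$ is the category of Yetter-Drinfel'd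 modules over the braided system $C=R$, $A=S$ in sets (with the Cartesian product, written $\otimes$), with $\sigma_{C,C}(r\otimes r')=r'\otimes r'$, $\sigma_{A,A}(s\otimes s')=s'\otimes(s\lhd s')$, $\sigma_{C,A}(r\otimes s)=s\otimes(r\cdot s)$; $\mathcal{YD}_{\Bbbk S}^{\Bbbk R}$ is the same for the linearized system in vector spaces. A YD module over $(C,A;\sigma_{C,C},\sigma_{A,A},\sigma_{C,A})$ is an object $M$ with $\rho\colon M\otimes A\to M$, $\delta\colon M\to M\otimes C$ such that $\rho(\rho\otimes A)=\rho(\rho\otimes A)(M\otimes\sigma_{A,A})$, $(\delta\otimes C)\delta=(M\otimes\sigma_{C,C})(\delta\otimes C)\delta$ and $\delta\rho=(\rho\otimes C)(M\otimes\sigma_{C,A})(\delta\otimes A)$; morphisms commute with $\rho$ and $\delta$. A category inclusion is a fully faithful functor injective on objects. *)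

theory Defs
  imports "HOL-Algebra.Module" "HOL-Algebra.AbelCoset"
begin

section \<open>Categories, functors and category inclusions\<close>

text \<open>
  Hom-sets are indexed by source and target and need not be disjoint; accordingly composition
  and the arrow part of a functor take the objects involved as arguments.
\<close>

record ('o, 'a) cat =
  Ob  :: "'o set"
  Hom :: "'o \<Rightarrow> 'o \<Rightarrow> 'a set"
  Id  :: "'o \<Rightarrow> 'a"
  Cmp :: "'o \<Rightarrow> 'o \<Rightarrow> 'o \<Rightarrow> 'a \<Rightarrow> 'a \<Rightarrow> 'a"

locale category =
  fixes C :: "('o, 'a) cat"
  assumes Id_closed: "X \<in> Ob C \<Longrightarrow> Id C X \<in> Hom C X X"
    and Cmp_closed: "\<lbrakk>X \<in> Ob C; Y \<in> Ob C; Z \<in> Ob C; f \<in> Hom C X Y; g \<in> Hom C Y Z\<rbrakk>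
      \<Longrightarrow> Cmp C X Y Z g f \<in> Hom C X Z"
    and Cmp_Id_left: "\<lbrakk>X \<in> Ob C; Y \<in> Ob C; f \<in> Hom C X Y\<rbrakk> \<Longrightarrow> Cmp C X Y Y (Id C Y) f = f"
    and Cmp_Id_right: "\<lbrakk>X \<in> Ob C; Y \<in> Ob C; f \<in> Hom C X Y\<rbrakk> \<Longrightarrow> Cmp C X X Y f (Id C X) = f"
    and Cmp_assoc: "\<lbrakk>W \<in> Ob C; X \<in> Ob C; Y \<in> Ob C; Z \<in> Ob C;
        f \<in> Hom C W X; g \<in> Hom C X Y; h \<in> Hom C Y Z\<rbrakk>
      \<Longrightarrow> Cmp C W X Z (Cmp C X Y Z h g) f = Cmp C W Y Z h (Cmp C W X Y g f)"

locale category_functor = src: category C + tgt: category D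
  for C :: "('o, 'a) cat" and D :: "('p, 'b) cat" +
  fixes FO :: "'o \<Rightarrow> 'p" and FA :: "'o \<Rightarrow> 'o \<Rightarrow> 'a \<Rightarrow> 'b"
  assumes FO_closed: "X \<in> Ob C \<Longrightarrow> FO X \<in> Ob D"
    and FA_closed: "\<lbrakk>X \<in> Ob C; Y \<in> Ob C; f \<in> Hom C X Y\<rbrakk> \<Longrightarrow> FA X Y f \<in> Hom D (FO X) (FO Y)"
    and FA_Id: "X \<in> Ob C \<Longrightarrow> FA X X (Id C X) = Id D (FO X)"
    and FA_Cmp: "\<lbrakk>X \<in> Ob C; Y \<in> Ob C; Z \<in> Ob C; f \<in> Hom C X Y; g \<in> Hom C Y Z\<rbrakk>
      \<Longrightarrow> FA X Z (Cmp C X Y Z g f) = Cmp D (FO X) (FO Y) (FO Z) (FA Y Z g) (FA X Y f)"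

locale category_inclusion = category_functor +
  assumes faithful: "\<lbrakk>X \<in> Ob C; Y \<in> Ob C\<rbrakk> \<Longrightarrow> inj_on (FA X Y) (Hom C X Y)"
    and full: "\<lbrakk>X \<in> Ob C; Y \<in> Ob C\<rbrakk> \<Longrightarrow> FA X Y ` Hom C X Y = Hom D (FO X) (FO Y)"
    and inj_on_objects: "inj_on FO (Ob C)"


section \<open>Shelves and crossed modules of shelves\<close>

locale shelf =
  fixes X :: "'x set" and opn :: "'x \<Rightarrow> 'x \<Rightarrow> 'x"
  assumes opn_closed: "\<lbrakk>a \<in> X; b \<in> X\<rbrakk> \<Longrightarrow> opn a b \<in> X"
    and self_distrib: "\<lbrakk>a \<in> X; b \<in> X; c \<in> X\<rbrakk>
      \<Longrightarrow> opn (opn a b) c = opn (opn a c) (opn b c)"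

locale shelf_module = shelf S opS
  for S :: "'s set" and opS :: "'s \<Rightarrow> 's \<Rightarrow> 's" +
  fixes M :: "'m set" and act :: "'m \<Rightarrow> 's \<Rightarrow> 'm"
  assumes act_closed: "\<lbrakk>m \<in> M; s \<in> S\<rbrakk> \<Longrightarrow> act m s \<in> M"
    and act_distrib: "\<lbrakk>m \<in> M; s \<in> S; s' \<in> S\<rbrakk>
      \<Longrightarrow> act (act m s) s' = act (act m s') (opS s s')"

locale crossed_module_of_shelves =
  R: shelf R opR + S: shelf S opS + dot: shelf_module S opS R dot
  for R :: "'r set" and opR :: "'r \<Rightarrow> 'r \<Rightarrow> 'r"
    and S :: "'s set" and opS :: "'s \<Rightarrow> 's \<Rightarrow> 's"
    and dot :: "'r \<Rightarrow> 's \<Rightarrow> 'r" +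
  fixes \<pi> :: "'r \<Rightarrow> 's"
  assumes pi_closed: "r \<in> R \<Longrightarrow> \<pi> r \<in> S"
    and pi_hom: "\<lbrakk>r \<in> R; r' \<in> R\<rbrakk> \<Longrightarrow> \<pi> (opR r r') = opS (\<pi> r) (\<pi> r')"
    and dot_hom: "\<lbrakk>r \<in> R; r' \<in> R; s \<in> S\<rbrakk> \<Longrightarrow> dot (opR r r') s = opR (dot r s) (dot r' s)"
    and dot_pi: "\<lbrakk>r \<in> R; r' \<in> R\<rbrakk> \<Longrightarrow> dot r (\<pi> r') = opR r r'"
    and pi_dot: "\<lbrakk>r \<in> R; s \<in> S\<rbrakk> \<Longrightarrow> \<pi> (dot r s) = opS (\<pi> r) s"


section \<open>Representations in sets\<close>

text \<open>
  Objects of the categories below have their underlying set inside an arbitrary type. All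
  structure maps and morphisms are extensional (\<open>undefined\<close> off their domain), so that HOL
  equality of objects and of morphisms is mathematical equality.
\<close>

record ('m, 'r, 's) set_rep =
  rep_set :: "'m set"
  rep_act :: "'m \<Rightarrow> 's \<Rightarrow> 'm"
  rep_gr  :: "'m \<Rightarrow> 'r"

definition is_set_rep ::
  "'r set \<Rightarrow> 's set \<Rightarrow> ('s \<Rightarrow> 's \<Rightarrow> 's) \<Rightarrow> ('r \<Rightarrow> 's \<Rightarrow> 'r) \<Rightarrow> ('m, 'r, 's) set_rep \<Rightarrow> bool" where
  "is_set_rep R S opS dot M \<longleftrightarrow>
     rep_act M \<in> rep_set M \<rightarrow>\<^sub>E S \<rightarrow>\<^sub>E rep_set M \<and>
     shelf_module S opS (rep_set M) (rep_act M) \<and>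
     rep_gr M \<in> rep_set M \<rightarrow>\<^sub>E R \<and>
     (\<forall>m\<in>rep_set M. \<forall>s\<in>S. rep_gr M (rep_act M m s) = dot (rep_gr M m) s)"

definition set_rep_hom ::
  "'s set \<Rightarrow> ('m, 'r, 's) set_rep \<Rightarrow> ('m, 'r, 's) set_rep \<Rightarrow> ('m \<Rightarrow> 'm) set" where
  "set_rep_hom S M N = {f \<in> rep_set M \<rightarrow>\<^sub>E rep_set N.
     (\<forall>m\<in>rep_set M. \<forall>s\<in>S. f (rep_act M m s) = rep_act N (f m) s) \<and>
     (\<forall>m\<in>rep_set M. rep_gr N (f m) = rep_gr M m)}"

definition M_Set ::
  "'r set \<Rightarrow> 's set \<Rightarrow> ('s \<Rightarrow> 's \<Rightarrow> 's) \<Rightarrow> ('r \<Rightarrow> 's \<Rightarrow> 'r)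
   \<Rightarrow> (('m, 'r, 's) set_rep, 'm \<Rightarrow> 'm) cat" where
  "M_Set R S opS dot =
     \<lparr>Ob = {M. is_set_rep R S opS dot M},
      Hom = set_rep_hom S,
      Id = (\<lambda>M. \<lambda>m\<in>rep_set M. m),
      Cmp = (\<lambda>L M N g f. compose (rep_set L) g f)\<rparr>"


section \<open>Yetter-Drinfel'd modules in sets\<close>

record ('a, 'c) set_system =
  sys_C :: "'c set"
  sys_A :: "'a set"
  sig_CC :: "'c \<times> 'c \<Rightarrow> 'c \<times> 'c"
  sig_AA :: "'a \<times> 'a \<Rightarrow> 'a \<times> 'a"
  sig_CA :: "'c \<times> 'a \<Rightarrow> 'a \<times> 'c"

definition cm_system ::
  "'r set \<Rightarrow> 's set \<Rightarrow> ('s \<Rightarrow> 's \<Rightarrow> 's) \<Rightarrow> ('r \<Rightarrow> 's \<Rightarrow> 'r) \<Rightarrow> ('s, 'r) set_system" where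
  "cm_system R S opS dot =
     \<lparr>sys_C = R, sys_A = S,
      sig_CC = (\<lambda>(r, r'). (r', r')),
      sig_AA = (\<lambda>(s, s'). (s', opS s s')),
      sig_CA = (\<lambda>(r, s). (s, dot r s))\<rparr>"

record ('m, 'a, 'c) set_yd =
  yd_set   :: "'m set"
  yd_act   :: "'m \<times> 'a \<Rightarrow> 'm"
  yd_coact :: "'m \<Rightarrow> 'm \<times> 'c"

fun reassoc :: "('x \<times> 'y) \<times> 'z \<Rightarrow> 'x \<times> 'y \<times> 'z" where
  "reassoc ((x, y), z) = (x, y, z)"

fun reassoc_inv :: "'x \<times> 'y \<times> 'z \<Rightarrow> ('x \<times> 'y) \<times> 'z" where
  "reassoc_inv (x, y, z) = ((x, y), z)"

definition is_set_yd :: "('a, 'c) set_system \<Rightarrow> ('m, 'a, 'c) set_yd \<Rightarrow> bool" where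
  "is_set_yd B Y \<longleftrightarrow>
    (let M = yd_set Y; A = sys_A B; C = sys_C B; \<rho> = yd_act Y; \<delta> = yd_coact Y in
     \<rho> \<in> M \<times> A \<rightarrow>\<^sub>E M \<and>
     \<delta> \<in> M \<rightarrow>\<^sub>E M \<times> C \<and>
     (\<forall>t \<in> (M \<times> A) \<times> A.
        \<rho> (map_prod \<rho> id t) =
        \<rho> (map_prod \<rho> id (reassoc_inv (map_prod id (sig_AA B) (reassoc t))))) \<and>
     (\<forall>m \<in> M.
        map_prod \<delta> id (\<delta> m) =
        reassoc_inv (map_prod id (sig_CC B) (reassoc (map_prod \<delta> id (\<delta> m))))) \<and>
     (\<forall>t \<in> M \<times> A.
        \<delta> (\<rho> t) =
        map_prod \<rho> id (reassoc_inv (map_prod id (sig_CA B) (reassoc (map_prod \<delta> id t))))))"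

definition set_yd_hom ::
  "('a, 'c) set_system \<Rightarrow> ('m, 'a, 'c) set_yd \<Rightarrow> ('m, 'a, 'c) set_yd \<Rightarrow> ('m \<Rightarrow> 'm) set" where
  "set_yd_hom B Y Z = {f \<in> yd_set Y \<rightarrow>\<^sub>E yd_set Z.
     (\<forall>t \<in> yd_set Y \<times> sys_A B. f (yd_act Y t) = yd_act Z (map_prod f id t)) \<and>
     (\<forall>m \<in> yd_set Y. yd_coact Z (f m) = map_prod f id (yd_coact Y m))}"

definition YD_Set :: "('a, 'c) set_system \<Rightarrow> (('m, 'a, 'c) set_yd, 'm \<Rightarrow> 'm) cat" where
  "YD_Set B =
     \<lparr>Ob = {Y. is_set_yd B Y},
      Hom = set_yd_hom B,
      Id = (\<lambda>Y. \<lambda>m\<in>yd_set Y. m),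
      Cmp = (\<lambda>X Y Z g f. compose (yd_set X) g f)\<rparr>"

definition set_rep_to_yd :: "'s set \<Rightarrow> ('m, 'r, 's) set_rep \<Rightarrow> ('m, 's, 'r) set_yd" where
  "set_rep_to_yd S M =
     \<lparr>yd_set = rep_set M,
      yd_act = (\<lambda>(m, s) \<in> rep_set M \<times> S. rep_act M m s),
      yd_coact = (\<lambda>m \<in> rep_set M. (m, rep_gr M m))\<rparr>"


section \<open>Vector spaces, free spaces and tensor products\<close>

definition lin_maps ::
  "('k, 'i) ring_scheme \<Rightarrow> ('k, 'v) module \<Rightarrow> ('k, 'w) module \<Rightarrow> ('v \<Rightarrow> 'w) set" where
  "lin_maps K V W = {f \<in> carrier V \<rightarrow>\<^sub>E carrier W.
     (\<forall>x\<in>carrier V. \<forall>y\<in>carrier V. f (x \<oplus>\<^bsub>V\<^esub> y) = f x \<oplus>\<^bsub>W\<^esub> f y) \<and>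
     (\<forall>a\<in>carrier K. \<forall>x\<in>carrier V. f (a \<odot>\<^bsub>V\<^esub> x) = a \<odot>\<^bsub>W\<^esub> f x)}"

text \<open>
  \<open>the_lin K V W P\<close> is only used with conditions \<open>P\<close> that prescribe a linear map on a spanning set and
  are satisfied by exactly one linear map.
\<close>

definition the_lin ::
  "('k, 'i) ring_scheme \<Rightarrow> ('k, 'v) module \<Rightarrow> ('k, 'w) module
   \<Rightarrow> (('v \<Rightarrow> 'w) \<Rightarrow> bool) \<Rightarrow> 'v \<Rightarrow> 'w" where
  "the_lin K V W P = (THE f. f \<in> lin_maps K V W \<and> P f)"

abbreviation id_on :: "('k, 'v) module \<Rightarrow> 'v \<Rightarrow> 'v" where
  "id_on V \<equiv> \<lambda>x\<in>carrier V. x"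

text \<open>
  The record type \<^typ>\<open>('k, 'v) module\<close> extends rings, so a module carries irrelevant
  \<open>mult\<close> and \<open>one\<close> fields; they are left unspecified (\<open>undefined\<close>) throughout.
\<close>

definition free_space ::
  "('k, 'i) ring_scheme \<Rightarrow> 'x set \<Rightarrow> ('k, 'x \<Rightarrow> 'k) module" where
  "free_space K X =
     \<lparr>carrier = {f \<in> X \<rightarrow>\<^sub>E carrier K. finite {x \<in> X. f x \<noteq> \<zero>\<^bsub>K\<^esub>}},
      mult = undefined, one = undefined,
      zero = (\<lambda>x\<in>X. \<zero>\<^bsub>K\<^esub>),
      add = (\<lambda>f g. \<lambda>x\<in>X. f x \<oplus>\<^bsub>K\<^esub> g x),
      smult = (\<lambda>a f. \<lambda>x\<in>X. a \<otimes>\<^bsub>K\<^esub> f x)\<rparr>"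

definition basis :: "('k, 'i) ring_scheme \<Rightarrow> 'x set \<Rightarrow> 'x \<Rightarrow> 'x \<Rightarrow> 'k" where
  "basis K X x = (\<lambda>y\<in>X. if y = x then \<one>\<^bsub>K\<^esub> else \<zero>\<^bsub>K\<^esub>)"

definition submodule_gen ::
  "('k, 'i) ring_scheme \<Rightarrow> ('k, 'v) module \<Rightarrow> 'v set \<Rightarrow> 'v set" where
  "submodule_gen K V G = \<Inter>{H. submodule H K V \<and> G \<subseteq> H}"

definition quotient_space ::
  "('k, 'i) ring_scheme \<Rightarrow> ('k, 'v) module \<Rightarrow> 'v set \<Rightarrow> ('k, 'v set) module" where
  "quotient_space K V H =
     \<lparr>carrier = a_rcosets\<^bsub>V\<^esub> H,
      mult = undefined, one = undefined,
      zero = H,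
      add = set_add V,
      smult = (\<lambda>a T. \<Union>t\<in>T. H +>\<^bsub>V\<^esub> (a \<odot>\<^bsub>V\<^esub> t))\<rparr>"

text \<open>
  The tensor product is the quotient of the free space on \<open>V \<times> W\<close> by the bilinearity relations.
\<close>

definition tensor_relations ::
  "('k, 'i) ring_scheme \<Rightarrow> ('k, 'v) module \<Rightarrow> ('k, 'w) module \<Rightarrow> ('v \<times> 'w \<Rightarrow> 'k) set" where
  "tensor_relations K V W =
    (let F = free_space K (carrier V \<times> carrier W);
         e = (\<lambda>v w. basis K (carrier V \<times> carrier W) (v, w)) in
     submodule_gen K F
      ({e (v \<oplus>\<^bsub>V\<^esub> v') w \<ominus>\<^bsub>F\<^esub> (e v w \<oplus>\<^bsub>F\<^esub> e v' w) | v v' w.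
          v \<in> carrier V \<and> v' \<in> carrier V \<and> w \<in> carrier W} \<union>
       {e v (w \<oplus>\<^bsub>W\<^esub> w') \<ominus>\<^bsub>F\<^esub> (e v w \<oplus>\<^bsub>F\<^esub> e v w') | v w w'.
          v \<in> carrier V \<and> w \<in> carrier W \<and> w' \<in> carrier W} \<union>
       {e (a \<odot>\<^bsub>V\<^esub> v) w \<ominus>\<^bsub>F\<^esub> (a \<odot>\<^bsub>F\<^esub> e v w) | a v w.
          a \<in> carrier K \<and> v \<in> carrier V \<and> w \<in> carrier W} \<union>
       {e v (a \<odot>\<^bsub>W\<^esub> w) \<ominus>\<^bsub>F\<^esub> (a \<odot>\<^bsub>F\<^esub> e v w) | a v w.
          a \<in> carrier K \<and> v \<in> carrier V \<and> w \<in> carrier W}))"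

type_synonym ('v, 'w, 'k) tensor = "('v \<times> 'w \<Rightarrow> 'k) set"

definition tensor_space ::
  "('k, 'i) ring_scheme \<Rightarrow> ('k, 'v) module \<Rightarrow> ('k, 'w) module \<Rightarrow> ('k, ('v, 'w, 'k) tensor) module" where
  "tensor_space K V W =
     quotient_space K (free_space K (carrier V \<times> carrier W)) (tensor_relations K V W)"

definition tens ::
  "('k, 'i) ring_scheme \<Rightarrow> ('k, 'v) module \<Rightarrow> ('k, 'w) module \<Rightarrow> 'v \<Rightarrow> 'w \<Rightarrow> ('v, 'w, 'k) tensor" where
  "tens K V W v w =
     tensor_relations K V W +>\<^bsub>free_space K (carrier V \<times> carrier W)\<^esub>
       basis K (carrier V \<times> carrier W) (v, w)"

definition tensor_map ::
  "('k, 'i) ring_scheme \<Rightarrow> ('k, 'v) module \<Rightarrow> ('k, 'w) module \<Rightarrow> ('k, 'v1) module \<Rightarrow> ('k, 'w1) module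
   \<Rightarrow> ('v \<Rightarrow> 'v1) \<Rightarrow> ('w \<Rightarrow> 'w1) \<Rightarrow> ('v, 'w, 'k) tensor \<Rightarrow> ('v1, 'w1, 'k) tensor" where
  "tensor_map K V W V' W' f g =
     the_lin K (tensor_space K V W) (tensor_space K V' W')
       (\<lambda>h. \<forall>v\<in>carrier V. \<forall>w\<in>carrier W. h (tens K V W v w) = tens K V' W' (f v) (g w))"

definition tensor_assoc ::
  "('k, 'i) ring_scheme \<Rightarrow> ('k, 'u) module \<Rightarrow> ('k, 'v) module \<Rightarrow> ('k, 'w) module
   \<Rightarrow> (('u, 'v, 'k) tensor, 'w, 'k) tensor \<Rightarrow> ('u, ('v, 'w, 'k) tensor, 'k) tensor" where
  "tensor_assoc K U V W =
     the_lin K (tensor_space K (tensor_space K U V) W) (tensor_space K U (tensor_space K V W))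
       (\<lambda>h. \<forall>u\<in>carrier U. \<forall>v\<in>carrier V. \<forall>w\<in>carrier W.
          h (tens K (tensor_space K U V) W (tens K U V u v) w) =
          tens K U (tensor_space K V W) u (tens K V W v w))"

definition tensor_assoc_inv ::
  "('k, 'i) ring_scheme \<Rightarrow> ('k, 'u) module \<Rightarrow> ('k, 'v) module \<Rightarrow> ('k, 'w) module
   \<Rightarrow> ('u, ('v, 'w, 'k) tensor, 'k) tensor \<Rightarrow> (('u, 'v, 'k) tensor, 'w, 'k) tensor" where
  "tensor_assoc_inv K U V W =
     the_lin K (tensor_space K U (tensor_space K V W)) (tensor_space K (tensor_space K U V) W)
       (\<lambda>h. \<forall>u\<in>carrier U. \<forall>v\<in>carrier V. \<forall>w\<in>carrier W.
          h (tens K U (tensor_space K V W) u (tens K V W v w)) =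
          tens K (tensor_space K U V) W (tens K U V u v) w)"

text \<open>
  Vector spaces that occur as (parts of) objects: modules over the field, with the operations
  normalised off the carrier and the two irrelevant record fields fixed, so that equality of
  records is equality of vector spaces.
\<close>

definition is_vector_space :: "('k, 'i) ring_scheme \<Rightarrow> ('k, 'v) module \<Rightarrow> bool" where
  "is_vector_space K V \<longleftrightarrow> module K V \<and> mult V = undefined \<and> one V = undefined \<and>
     (\<forall>x y. \<not> (x \<in> carrier V \<and> y \<in> carrier V) \<longrightarrow> x \<oplus>\<^bsub>V\<^esub> y = undefined) \<and>
     (\<forall>a x. \<not> (a \<in> carrier K \<and> x \<in> carrier V) \<longrightarrow> a \<odot>\<^bsub>V\<^esub> x = undefined)"

definition is_decomposition ::
  "('k, 'v) module \<Rightarrow> 'j set \<Rightarrow> ('j \<Rightarrow> 'v set) \<Rightarrow> 'v \<Rightarrow> ('j \<Rightarrow> 'v) \<Rightarrow> bool" where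
  "is_decomposition V I N m x \<longleftrightarrow> x \<in> Pi\<^sub>E I N \<and> finite {i \<in> I. x i \<noteq> \<zero>\<^bsub>V\<^esub>} \<and>
     m = (\<Oplus>\<^bsub>V\<^esub>i\<in>{i \<in> I. x i \<noteq> \<zero>\<^bsub>V\<^esub>}. x i)"

definition is_direct_sum ::
  "('k, 'i) ring_scheme \<Rightarrow> ('k, 'v) module \<Rightarrow> 'j set \<Rightarrow> ('j \<Rightarrow> 'v set) \<Rightarrow> bool" where
  "is_direct_sum K V I N \<longleftrightarrow> (\<forall>i\<in>I. submodule (N i) K V) \<and>
     (\<forall>m\<in>carrier V. \<exists>!x. is_decomposition V I N m x)"

definition components :: "('k, 'v) module \<Rightarrow> 'j set \<Rightarrow> ('j \<Rightarrow> 'v set) \<Rightarrow> 'v \<Rightarrow> 'j \<Rightarrow> 'v" where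
  "components V I N m = (THE x. is_decomposition V I N m x)"


section \<open>Representations in vector spaces\<close>

record ('k, 'v, 'r, 's) lin_rep =
  lrep_space :: "('k, 'v) module"
  lrep_act   :: "'v \<Rightarrow> 's \<Rightarrow> 'v"
  lrep_gr    :: "'r \<Rightarrow> 'v set"

definition is_lin_rep ::
  "('k, 'i) ring_scheme \<Rightarrow> 'r set \<Rightarrow> 's set \<Rightarrow> ('s \<Rightarrow> 's \<Rightarrow> 's) \<Rightarrow> ('r \<Rightarrow> 's \<Rightarrow> 'r)
   \<Rightarrow> ('k, 'v, 'r, 's) lin_rep \<Rightarrow> bool" where
  "is_lin_rep K R S opS dot M \<longleftrightarrow>
    (let V = lrep_space M in
     is_vector_space K V \<and>
     lrep_act M \<in> carrier V \<rightarrow>\<^sub>E S \<rightarrow>\<^sub>E carrier V \<and>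
     shelf_module S opS (carrier V) (lrep_act M) \<and>
     (\<forall>s\<in>S. (\<lambda>m\<in>carrier V. lrep_act M m s) \<in> lin_maps K V V) \<and>
     lrep_gr M \<in> extensional R \<and>
     is_direct_sum K V R (lrep_gr M) \<and>
     (\<forall>r\<in>R. \<forall>s\<in>S. \<forall>m\<in>lrep_gr M r. lrep_act M m s \<in> lrep_gr M (dot r s)))"

definition lin_rep_hom ::
  "('k, 'i) ring_scheme \<Rightarrow> 'r set \<Rightarrow> 's set
   \<Rightarrow> ('k, 'v, 'r, 's) lin_rep \<Rightarrow> ('k, 'v, 'r, 's) lin_rep \<Rightarrow> ('v \<Rightarrow> 'v) set" where
  "lin_rep_hom K R S M N = {f \<in> lin_maps K (lrep_space M) (lrep_space N).
     (\<forall>m\<in>carrier (lrep_space M). \<forall>s\<in>S. f (lrep_act M m s) = lrep_act N (f m) s) \<and>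
     (\<forall>r\<in>R. f ` lrep_gr M r \<subseteq> lrep_gr N r)}"

definition M_Lin ::
  "('k, 'i) ring_scheme \<Rightarrow> 'r set \<Rightarrow> 's set \<Rightarrow> ('s \<Rightarrow> 's \<Rightarrow> 's) \<Rightarrow> ('r \<Rightarrow> 's \<Rightarrow> 'r)
   \<Rightarrow> (('k, 'v, 'r, 's) lin_rep, 'v \<Rightarrow> 'v) cat" where
  "M_Lin K R S opS dot =
     \<lparr>Ob = {M. is_lin_rep K R S opS dot M},
      Hom = lin_rep_hom K R S,
      Id = (\<lambda>M. id_on (lrep_space M)),
      Cmp = (\<lambda>L M N g f. compose (carrier (lrep_space L)) g f)\<rparr>"


section \<open>Yetter-Drinfel'd modules in vector spaces\<close>

record ('k, 'a, 'c) lin_system =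
  lsys_C :: "('k, 'c) module"
  lsys_A :: "('k, 'a) module"
  lsig_CC :: "('c, 'c, 'k) tensor \<Rightarrow> ('c, 'c, 'k) tensor"
  lsig_AA :: "('a, 'a, 'k) tensor \<Rightarrow> ('a, 'a, 'k) tensor"
  lsig_CA :: "('c, 'a, 'k) tensor \<Rightarrow> ('a, 'c, 'k) tensor"

definition linearize_map ::
  "('k, 'i) ring_scheme \<Rightarrow> 'x set \<Rightarrow> 'y set \<Rightarrow> 'z set \<Rightarrow> 'w set \<Rightarrow> ('x \<times> 'y \<Rightarrow> 'z \<times> 'w)
   \<Rightarrow> ('x \<Rightarrow> 'k, 'y \<Rightarrow> 'k, 'k) tensor \<Rightarrow> ('z \<Rightarrow> 'k, 'w \<Rightarrow> 'k, 'k) tensor" where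
  "linearize_map K X Y Z W g =
    (let kX = free_space K X; kY = free_space K Y; kZ = free_space K Z; kW = free_space K W in
     the_lin K (tensor_space K kX kY) (tensor_space K kZ kW)
       (\<lambda>h. \<forall>x\<in>X. \<forall>y\<in>Y. h (tens K kX kY (basis K X x) (basis K Y y)) =
          tens K kZ kW (basis K Z (fst (g (x, y)))) (basis K W (snd (g (x, y))))))"

definition linearize_system ::
  "('k, 'i) ring_scheme \<Rightarrow> ('a, 'c) set_system \<Rightarrow> ('k, 'a \<Rightarrow> 'k, 'c \<Rightarrow> 'k) lin_system" where
  "linearize_system K B =
     \<lparr>lsys_C = free_space K (sys_C B),
      lsys_A = free_space K (sys_A B),
      lsig_CC = linearize_map K (sys_C B) (sys_C B) (sys_C B) (sys_C B) (sig_CC B),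
      lsig_AA = linearize_map K (sys_A B) (sys_A B) (sys_A B) (sys_A B) (sig_AA B),
      lsig_CA = linearize_map K (sys_C B) (sys_A B) (sys_A B) (sys_C B) (sig_CA B)\<rparr>"

record ('k, 'v, 'a, 'c) lin_yd =
  lyd_space :: "('k, 'v) module"
  lyd_act   :: "('v, 'a, 'k) tensor \<Rightarrow> 'v"
  lyd_coact :: "'v \<Rightarrow> ('v, 'c, 'k) tensor"

definition is_lin_yd ::
  "('k, 'i) ring_scheme \<Rightarrow> ('k, 'a, 'c) lin_system \<Rightarrow> ('k, 'v, 'a, 'c) lin_yd \<Rightarrow> bool" where
  "is_lin_yd K B Y \<longleftrightarrow>
    (let M = lyd_space Y; A = lsys_A B; C = lsys_C B; \<rho> = lyd_act Y; \<delta> = lyd_coact Y;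
         MA = tensor_space K M A; MC = tensor_space K M C;
         AA = tensor_space K A A; CC = tensor_space K C C;
         CA = tensor_space K C A; AC = tensor_space K A C in
     is_vector_space K M \<and>
     \<rho> \<in> lin_maps K MA M \<and>
     \<delta> \<in> lin_maps K M MC \<and>
     (\<forall>t \<in> carrier (tensor_space K MA A).
        \<rho> (tensor_map K MA A M A \<rho> (id_on A) t) =
        \<rho> (tensor_map K MA A M A \<rho> (id_on A)
            (tensor_assoc_inv K M A A
              (tensor_map K M AA M AA (id_on M) (lsig_AA B)
                (tensor_assoc K M A A t))))) \<and>
     (\<forall>m \<in> carrier M.
        tensor_map K M C MC C \<delta> (id_on C) (\<delta> m) =
        tensor_assoc_inv K M C C
          (tensor_map K M CC M CC (id_on M) (lsig_CC B)
            (tensor_assoc K M C C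
              (tensor_map K M C MC C \<delta> (id_on C) (\<delta> m))))) \<and>
     (\<forall>t \<in> carrier MA.
        \<delta> (\<rho> t) =
        tensor_map K MA C M C \<rho> (id_on C)
          (tensor_assoc_inv K M A C
            (tensor_map K M CA M AC (id_on M) (lsig_CA B)
              (tensor_assoc K M C A
                (tensor_map K M A MC A \<delta> (id_on A) t))))))"

definition lin_yd_hom ::
  "('k, 'i) ring_scheme \<Rightarrow> ('k, 'a, 'c) lin_system
   \<Rightarrow> ('k, 'v, 'a, 'c) lin_yd \<Rightarrow> ('k, 'v, 'a, 'c) lin_yd \<Rightarrow> ('v \<Rightarrow> 'v) set" where
  "lin_yd_hom K B Y Z =
    (let M = lyd_space Y; N = lyd_space Z; A = lsys_A B; C = lsys_C B in
     {f \<in> lin_maps K M N.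
       (\<forall>t \<in> carrier (tensor_space K M A).
          f (lyd_act Y t) = lyd_act Z (tensor_map K M A N A f (id_on A) t)) \<and>
       (\<forall>m \<in> carrier M.
          lyd_coact Z (f m) = tensor_map K M C N C f (id_on C) (lyd_coact Y m))})"

definition YD_Lin ::
  "('k, 'i) ring_scheme \<Rightarrow> ('k, 'a, 'c) lin_system \<Rightarrow> (('k, 'v, 'a, 'c) lin_yd, 'v \<Rightarrow> 'v) cat" where
  "YD_Lin K B =
     \<lparr>Ob = {Y. is_lin_yd K B Y},
      Hom = lin_yd_hom K B,
      Id = (\<lambda>Y. id_on (lyd_space Y)),
      Cmp = (\<lambda>X Y Z g f. compose (carrier (lyd_space X)) g f)\<rparr>"

text \<open>The coaction is \<open>m \<mapsto> \<Sum>\<^sub>r m\<^sub>r \<otimes> r\<close>, the sum being over the support of \<open>m\<close>.\<close>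

definition lin_rep_to_yd ::
  "('k, 'i) ring_scheme \<Rightarrow> 'r set \<Rightarrow> 's set
   \<Rightarrow> ('k, 'v, 'r, 's) lin_rep \<Rightarrow> ('k, 'v, 's \<Rightarrow> 'k, 'r \<Rightarrow> 'k) lin_yd" where
  "lin_rep_to_yd K R S M =
    (let V = lrep_space M; kS = free_space K S; kR = free_space K R;
         c = components V R (lrep_gr M) in
     \<lparr>lyd_space = V,
      lyd_act = the_lin K (tensor_space K V kS) V
        (\<lambda>h. \<forall>m\<in>carrier V. \<forall>s\<in>S. h (tens K V kS m (basis K S s)) = lrep_act M m s),
      lyd_coact = (\<lambda>m\<in>carrier V.
        \<Oplus>\<^bsub>tensor_space K V kR\<^esub>r\<in>{r \<in> R. c m r \<noteq> \<zero>\<^bsub>V\<^esub>}. tens K V kR (c m r) (basis K R r))\<rparr>)"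

end

theory Submission
  imports Defs
begin

text \<open>
  In sets the statement is a matter of unfolding. The coaction of a representation is
  \<open>m \<mapsto> (m, gr m)\<close>, so the braided coassociativity
  condition reads \<open>((m, gr m), gr m) = ((m, gr m), gr m)\<close>, the action condition is the defining
  identity of an \<open>S\<close>-module, and the compatibility of action and coaction says
  \<open>gr (m s) = gr m \<cdot> s\<close>. A map commutes with these coactions exactly if it preserves gradings, and
  the second component of the coaction recovers \<open>gr\<close>.

  In vector spaces the same computation is carried out on generators. All maps in the axioms of a
  Yetter-Drinfel'd module are linear, and \<open>V \<otimes> \<Bbbk>S\<close> is spanned by the tensors \<open>m \<otimes> s\<close> with \<open>m\<close> in
  any spanning set of \<open>V\<close>; because \<open>V\<close> is the direct sum of the \<open>V\<^sub>r\<close>, one may take \<open>m\<close>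
  homogeneous. For \<open>m \<in> V\<^sub>r\<close> the coaction \<open>m \<mapsto> \<Sum>\<^sub>r m\<^sub>r \<otimes> r\<close> is simply \<open>m \<mapsto> m \<otimes> r\<close>, and each axiom
  becomes its analogue in sets (\<open>yd_action_axiom\<close>, \<open>yd_coaction_axiom\<close>,
  \<open>yd_compatibility_axiom\<close>).

  Fullness and injectivity on objects both rest on \<open>homogeneous_iff_coaction\<close>: the coaction
  \<open>\<delta>\<close> determines the grading, since \<open>m \<in> V\<^sub>r\<close> if and only if \<open>\<delta> m = m \<otimes> r\<close>. For the nontrivial
  direction, the linear projection \<open>V \<otimes> \<Bbbk>R \<rightarrow> V\<close> onto the coefficient of \<open>r\<close> maps \<open>\<delta> m\<close> to the
  component \<open>m\<^sub>r\<close> and \<open>m \<otimes> r\<close> to \<open>m\<close>, so \<open>m = m\<^sub>r\<close>. Hence a linear map that commutes with the coactions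
  sends \<open>V\<^sub>r\<close> to the vectors \<open>n\<close> with \<open>\<delta> n = n \<otimes> r\<close>, that is, preserves the grading.

  What carries this argument is the universal property of the tensor product
  (\<open>tensor_universal\<close>), from which the structural maps between tensor products are constructed
  and evaluated on pure tensors. It is developed for modules over a commutative ring.
\<close>

section \<open>Linear maps and spanning sets\<close>

text \<open>
  Linearity on the carrier, with no condition on the values outside it: in contrast to
  \<open>lin_maps\<close> it is preserved by plain composition, so a long composite of structural maps is seen to
  be linear by chaining \<open>is_linear_comp\<close>.
\<close>

definition is_linear ::
  "('k, 'i) ring_scheme \<Rightarrow> ('k, 'v) module \<Rightarrow> ('k, 'w) module \<Rightarrow> ('v \<Rightarrow> 'w) \<Rightarrow> bool" where
  "is_linear K V W f \<longleftrightarrow> f \<in> carrier V \<rightarrow> carrier W \<and>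
     (\<forall>x\<in>carrier V. \<forall>y\<in>carrier V. f (x \<oplus>\<^bsub>V\<^esub> y) = f x \<oplus>\<^bsub>W\<^esub> f y) \<and>
     (\<forall>a\<in>carrier K. \<forall>x\<in>carrier V. f (a \<odot>\<^bsub>V\<^esub> x) = a \<odot>\<^bsub>W\<^esub> f x)"

lemma is_linear_closed: "is_linear K V W f \<Longrightarrow> x \<in> carrier V \<Longrightarrow> f x \<in> carrier W"
  and is_linear_add: "is_linear K V W f \<Longrightarrow> x \<in> carrier V \<Longrightarrow> y \<in> carrier V
    \<Longrightarrow> f (x \<oplus>\<^bsub>V\<^esub> y) = f x \<oplus>\<^bsub>W\<^esub> f y"
  and is_linear_smult: "is_linear K V W f \<Longrightarrow> a \<in> carrier K \<Longrightarrow> x \<in> carrier V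
    \<Longrightarrow> f (a \<odot>\<^bsub>V\<^esub> x) = a \<odot>\<^bsub>W\<^esub> f x"
  by (auto simp: is_linear_def)

lemma is_linearI:
  assumes "\<And>x. x \<in> carrier V \<Longrightarrow> f x \<in> carrier W"
    and "\<And>x y. x \<in> carrier V \<Longrightarrow> y \<in> carrier V \<Longrightarrow> f (x \<oplus>\<^bsub>V\<^esub> y) = f x \<oplus>\<^bsub>W\<^esub> f y"
    and "\<And>a x. a \<in> carrier K \<Longrightarrow> x \<in> carrier V \<Longrightarrow> f (a \<odot>\<^bsub>V\<^esub> x) = a \<odot>\<^bsub>W\<^esub> f x"
  shows "is_linear K V W f"
  using assms by (auto simp: is_linear_def)

lemma lin_maps_iff: "f \<in> lin_maps K V W \<longleftrightarrow> is_linear K V W f \<and> f \<in> extensional (carrier V)"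
  by (auto simp: lin_maps_def is_linear_def PiE_def)

lemma lin_maps_linear: "f \<in> lin_maps K V W \<Longrightarrow> is_linear K V W f"
  by (simp add: lin_maps_iff)

lemma is_linear_cong:
  assumes "module K V" "is_linear K V W f" "\<And>x. x \<in> carrier V \<Longrightarrow> g x = f x"
  shows "is_linear K V W g"
proof -
  interpret V: module K V by fact
  show ?thesis using assms(2,3) by (simp add: is_linear_def Pi_iff)
qed

lemma restrict_lin_maps:
  assumes "module K V" "is_linear K V W f"
  shows "restrict f (carrier V) \<in> lin_maps K V W"
  using is_linear_cong[OF assms, of "restrict f (carrier V)"] by (simp add: lin_maps_iff)

lemma is_linear_id: "is_linear K V V (\<lambda>x. x)"
  by (simp add: is_linear_def)

lemma is_linear_id_on: "module K V \<Longrightarrow> is_linear K V V (id_on V)"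
  by (erule is_linear_cong[OF _ is_linear_id]) simp

lemma is_linear_comp:
  assumes "is_linear K U V f" "is_linear K V W g"
  shows "is_linear K U W (\<lambda>x. g (f x))"
  using assms by (auto simp: is_linear_def Pi_iff)

lemma is_linear_const_zero:
  assumes "module K W"
  shows "is_linear K V W (\<lambda>x. \<zero>\<^bsub>W\<^esub>)"
proof -
  interpret W: module K W by fact
  show ?thesis by (simp add: is_linear_def)
qed

lemma is_linear_plus:
  assumes "module K W" "is_linear K V W f" "is_linear K V W g"
  shows "is_linear K V W (\<lambda>x. f x \<oplus>\<^bsub>W\<^esub> g x)"
proof -
  interpret W: module K W by fact
  show ?thesis using assms(2,3)
    by (auto simp: is_linear_def Pi_iff W.smult_r_distr W.M.a_ac)
qed

lemma is_linear_scale: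
  assumes "module K W" "is_linear K V W f" "a \<in> carrier K"
  shows "is_linear K V W (\<lambda>x. a \<odot>\<^bsub>W\<^esub> f x)"
proof -
  interpret W: module K W by fact
  show ?thesis using assms(2,3)
    by (auto simp: is_linear_def Pi_iff W.smult_r_distr W.smult_assoc1[symmetric] W.R.m_comm)
qed

lemma is_linear_zero:
  assumes "module K V" "module K W" "is_linear K V W f"
  shows "f \<zero>\<^bsub>V\<^esub> = \<zero>\<^bsub>W\<^esub>"
proof -
  interpret V: module K V by fact
  interpret W: module K W by fact
  have "f (\<zero>\<^bsub>K\<^esub> \<odot>\<^bsub>V\<^esub> \<zero>\<^bsub>V\<^esub>) = \<zero>\<^bsub>K\<^esub> \<odot>\<^bsub>W\<^esub> f \<zero>\<^bsub>V\<^esub>"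
    using assms(3) by (intro is_linear_smult) auto
  then show ?thesis using is_linear_closed[OF assms(3)] by simp
qed

lemma module_a_inv:
  assumes "module K V" "x \<in> carrier V"
  shows "\<ominus>\<^bsub>V\<^esub> x = (\<ominus>\<^bsub>K\<^esub> \<one>\<^bsub>K\<^esub>) \<odot>\<^bsub>V\<^esub> x"
proof -
  interpret V: module K V by fact
  show ?thesis using assms(2) by (simp add: V.smult_l_minus)
qed

lemma is_linear_minus:
  assumes "module K V" "module K W" "is_linear K V W f" "x \<in> carrier V"  "y \<in> carrier V"
  shows "f (x \<ominus>\<^bsub>V\<^esub> y) = f x \<ominus>\<^bsub>W\<^esub> f y"
proof -
  interpret V: module K V by fact
  interpret W: module K W by fact
  have "\<ominus>\<^bsub>K\<^esub> \<one>\<^bsub>K\<^esub> \<in> carrier K" by simp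
  then show ?thesis using assms
    by (simp add: a_minus_def is_linear_add is_linear_smult is_linear_closed module_a_inv)
qed

lemma submoduleI_add_smult:
  assumes "module K V" "H \<subseteq> carrier V" "\<zero>\<^bsub>V\<^esub> \<in> H"
    and "\<And>x y. x \<in> H \<Longrightarrow> y \<in> H \<Longrightarrow> x \<oplus>\<^bsub>V\<^esub> y \<in> H"
    and "\<And>a x. a \<in> carrier K \<Longrightarrow> x \<in> H \<Longrightarrow> a \<odot>\<^bsub>V\<^esub> x \<in> H"
  shows "submodule H K V"
proof -
  interpret V: module K V by fact
  show ?thesis
  proof (rule V.submoduleI)
    fix x assume "x \<in> H"
    then show "\<ominus>\<^bsub>V\<^esub> x \<in> H" using assms(2) assms(5)[of "\<ominus>\<^bsub>K\<^esub> \<one>\<^bsub>K\<^esub>" x] module_a_inv[OF assms(1), of x]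
      by auto
  qed (use assms in auto)
qed

lemma submoduleD:
  assumes "module K V" "submodule H K V"
  shows "H \<subseteq> carrier V" "\<zero>\<^bsub>V\<^esub> \<in> H"
    "\<And>x y. x \<in> H \<Longrightarrow> y \<in> H \<Longrightarrow> x \<oplus>\<^bsub>V\<^esub> y \<in> H"
    "\<And>a x. a \<in> carrier K \<Longrightarrow> x \<in> H \<Longrightarrow> a \<odot>\<^bsub>V\<^esub> x \<in> H"
    "\<And>x. x \<in> H \<Longrightarrow> \<ominus>\<^bsub>V\<^esub> x \<in> H"
proof -
  interpret V: module K V by fact
  show "H \<subseteq> carrier V" 
    "\<And>x y. x \<in> H \<Longrightarrow> y \<in> H \<Longrightarrow> x \<oplus>\<^bsub>V\<^esub> y \<in> H"
    "\<And>a x. a \<in> carrier K \<Longrightarrow> x \<in> H \<Longrightarrow> a \<odot>\<^bsub>V\<^esub> x \<in> H"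
    "\<And>x. x \<in> H \<Longrightarrow> \<ominus>\<^bsub>V\<^esub> x \<in> H"
    using V.submoduleE[OF assms(2)] by auto
  show "\<zero>\<^bsub>V\<^esub> \<in> H"
    using subgroup.one_closed[OF submodule.axioms(1)[OF assms(2)]] by simp
qed

text \<open>
  Spanning is expressed by the closure property that the proofs use: an argument by generators
  needs a submodule containing them, never a linear combination of them.
\<close>

definition spans :: "('k, 'i) ring_scheme \<Rightarrow> ('k, 'v) module \<Rightarrow> 'v set \<Rightarrow> bool" where
  "spans K V G \<longleftrightarrow> G \<subseteq> carrier V \<and> (\<forall>H. submodule H K V \<longrightarrow> G \<subseteq> H \<longrightarrow> carrier V \<subseteq> H)"

lemma spans_carrier: "spans K V (carrier V)"
  by (simp add: spans_def)

lemma spansD: "spans K V G \<Longrightarrow> submodule H K V \<Longrightarrow> G \<subseteq> H \<Longrightarrow> x \<in> carrier V \<Longrightarrow> x \<in> H"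
  by (auto simp: spans_def)

lemma preimage_submodule:
  assumes "module K V" "module K W" "is_linear K V W f" "submodule H K W"
  shows "submodule {x \<in> carrier V. f x \<in> H} K V"
proof -
  interpret V: module K V by fact
  interpret W: module K W by fact
  note H = submoduleD[OF assms(2,4)]
  show ?thesis
    by (rule submoduleI_add_smult)
      (use assms H in \<open>auto simp: is_linear_zero is_linear_add is_linear_smult\<close>)
qed

text \<open>
  The equaliser of two linear maps is a submodule.
\<close>

lemma linear_eq_on_span:
  assumes "module K V" "module K W" "is_linear K V W f" "is_linear K V W g"
    and "spans K V G" "\<And>x. x \<in> G \<Longrightarrow> f x = g x" "x \<in> carrier V"
  shows "f x = g x"
proof -
  interpret V: module K V by fact
  have "submodule {x \<in> carrier V. f x = g x} K V"
    by (rule submoduleI_add_smult)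
      (use assms(1-4) in \<open>auto simp: is_linear_zero is_linear_add is_linear_smult\<close>)
  moreover have "G \<subseteq> {x \<in> carrier V. f x = g x}"
    using assms by (auto simp: spans_def)
  ultimately show ?thesis using assms by (auto dest: spansD)
qed

lemma spans_image:
  assumes "module K V" "module K W" "is_linear K V W f" "f ` carrier V = carrier W" "spans K V G"
  shows "spans K W (f ` G)"
  unfolding spans_def
proof (intro conjI allI impI)
  show "f ` G \<subseteq> carrier W" using assms by (auto simp: spans_def)
next
  fix H assume H: "submodule H K W" "f ` G \<subseteq> H"
  have "G \<subseteq> {x \<in> carrier V. f x \<in> H}" using assms(5) H(2) by (auto simp: spans_def)
  then have "carrier V \<subseteq> {x \<in> carrier V. f x \<in> H}"
    using preimage_submodule[OF assms(1-3) H(1)] assms(5) unfolding spans_def by blast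
  then show "carrier W \<subseteq> H" unfolding assms(4)[symmetric] by blast
qed

text \<open>
  Turns a definition by \<open>the_lin\<close> into usable facts: uniqueness comes from a spanning set on which the
  prescription \<open>P\<close> fixes the values, so only some linear solution has to be exhibited. This solution is
  restricted to the carrier because members of \<open>lin_maps\<close> are extensional.
\<close>

lemma the_lin_unique:
  assumes "module K V" "module K W" "is_linear K V W f" "P (restrict f (carrier V))"
    and "spans K V G" "\<And>g g' x. P g \<Longrightarrow> P g' \<Longrightarrow> x \<in> G \<Longrightarrow> g x = g' x"
  shows "the_lin K V W P \<in> lin_maps K V W" "P (the_lin K V W P)"
proof -
  let ?f = "restrict f (carrier V)"
  have f: "?f \<in> lin_maps K V W" by (rule restrict_lin_maps[OF assms(1,3)])
  have "\<exists>!h. h \<in> lin_maps K V W \<and> P h"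
  proof (rule ex1I[of _ ?f])
    show "?f \<in> lin_maps K V W \<and> P ?f" using f assms by simp
    fix g assume g: "g \<in> lin_maps K V W \<and> P g"
    show "g = ?f"
    proof (rule extensionalityI)
      fix x assume "x \<in> carrier V"
      then show "g x = ?f x"
        using linear_eq_on_span[OF assms(1,2) _ _ assms(5), of g ?f x] assms(6)[of g ?f] assms(4) f g
        unfolding lin_maps_iff by blast
    qed (use f g in \<open>auto simp: lin_maps_iff\<close>)
  qed
  from theI'[OF this] show "the_lin K V W P \<in> lin_maps K V W" "P (the_lin K V W P)"
    by (auto simp: the_lin_def)
qed

section \<open>Finitely supported sums\<close>

text \<open>
  The sum of a family over its support, in the form in which \<open>is_decomposition\<close> and the coaction
  use it. For infinite support it is \<open>\<zero>\<close>, whence the finiteness hypotheses below.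
\<close>

definition fsum :: "('k, 'v) module \<Rightarrow> 'j set \<Rightarrow> ('j \<Rightarrow> 'v) \<Rightarrow> 'v" where
  "fsum V I x = (\<Oplus>\<^bsub>V\<^esub>i\<in>{i \<in> I. x i \<noteq> \<zero>\<^bsub>V\<^esub>}. x i)"

text \<open>
  Supports vary with the family, so sums of two families are compared over one common finite
  index set.
\<close>

lemma fsum_superset:
  assumes "module K V" "finite T" "T \<subseteq> I" "\<And>i. i \<in> I \<Longrightarrow> x i \<in> carrier V"
    and "\<And>i. i \<in> I - T \<Longrightarrow> x i = \<zero>\<^bsub>V\<^esub>"
  shows "fsum V I x = (\<Oplus>\<^bsub>V\<^esub>i\<in>T. x i)"
proof -
  interpret V: module K V by fact
  show ?thesis unfolding fsum_def
    by (rule V.M.add.finprod_mono_neutral_cong_left) (use assms in auto)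
qed

lemma fsum_closed:
  assumes "module K V" "\<And>i. i \<in> I \<Longrightarrow> x i \<in> carrier V"
  shows "fsum V I x \<in> carrier V"
proof -
  interpret V: module K V by fact
  show ?thesis unfolding fsum_def by (rule V.M.finsum_closed) (use assms in auto)
qed

lemma fsum_cong: "(\<And>i. i \<in> I \<Longrightarrow> x i = y i) \<Longrightarrow> (\<And>i. i \<in> I \<Longrightarrow> y i \<in> carrier V) \<Longrightarrow> module K V \<Longrightarrow> fsum V I x = fsum V I y"
proof -
  assume a: "\<And>i. i \<in> I \<Longrightarrow> x i = y i" "\<And>i. i \<in> I \<Longrightarrow> y i \<in> carrier V" and "module K V"
  then interpret V: module K V by simp
  have "{i \<in> I. x i \<noteq> \<zero>\<^bsub>V\<^esub>} = {i \<in> I. y i \<noteq> \<zero>\<^bsub>V\<^esub>}" using a by auto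
  then show ?thesis unfolding fsum_def by (intro V.M.finsum_cong') (use a in auto)
qed

lemma fsum_add:
  assumes "module K V" "\<And>i. i \<in> I \<Longrightarrow> x i \<in> carrier V" "\<And>i. i \<in> I \<Longrightarrow> y i \<in> carrier V"
    and "finite {i \<in> I. x i \<noteq> \<zero>\<^bsub>V\<^esub>}" "finite {i \<in> I. y i \<noteq> \<zero>\<^bsub>V\<^esub>}"
  shows "fsum V I (\<lambda>i. x i \<oplus>\<^bsub>V\<^esub> y i) = fsum V I x \<oplus>\<^bsub>V\<^esub> fsum V I y"
proof -
  interpret V: module K V by fact
  let ?T = "{i \<in> I. x i \<noteq> \<zero>\<^bsub>V\<^esub>} \<union> {i \<in> I. y i \<noteq> \<zero>\<^bsub>V\<^esub>}"
  have T: "finite ?T" using assms by simp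
  have *: "fsum V I x = (\<Oplus>\<^bsub>V\<^esub>i\<in>?T. x i)" "fsum V I y = (\<Oplus>\<^bsub>V\<^esub>i\<in>?T. y i)"
    "fsum V I (\<lambda>i. x i \<oplus>\<^bsub>V\<^esub> y i) = (\<Oplus>\<^bsub>V\<^esub>i\<in>?T. x i \<oplus>\<^bsub>V\<^esub> y i)"
    by (rule fsum_superset[OF assms(1) T]; use assms in auto)+
  show ?thesis unfolding * by (rule V.M.finsum_addf) (use assms in auto)
qed

lemma finsum_linear:
  assumes "module K V" "module K W" "is_linear K V W h" "finite T" "\<And>i. i \<in> T \<Longrightarrow> x i \<in> carrier V"
  shows "h (\<Oplus>\<^bsub>V\<^esub>i\<in>T. x i) = (\<Oplus>\<^bsub>W\<^esub>i\<in>T. h (x i))"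
proof -
  interpret V: module K V by fact
  interpret W: module K W by fact
  show ?thesis using assms(4,5)
  proof (induction T rule: finite_induct)
    case empty
    then show ?case using assms by (simp add: is_linear_zero)
  next
    case (insert i T)
    have "h (x i \<oplus>\<^bsub>V\<^esub> (\<Oplus>\<^bsub>V\<^esub>i\<in>T. x i)) = h (x i) \<oplus>\<^bsub>W\<^esub> h (\<Oplus>\<^bsub>V\<^esub>i\<in>T. x i)"
      using insert by (intro is_linear_add[OF assms(3)] V.M.finsum_closed) auto
    then show ?case using insert is_linear_closed[OF assms(3)]
      by (auto simp: V.M.finsum_insert W.M.finsum_insert Pi_iff)
  qed
qed

lemma fsum_linear:
  assumes "module K V" "module K W" "is_linear K V W h" "\<And>i. i \<in> I \<Longrightarrow> x i \<in> carrier V"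
    and "finite {i \<in> I. x i \<noteq> \<zero>\<^bsub>V\<^esub>}"
  shows "h (fsum V I x) = fsum W I (\<lambda>i. h (x i))"
proof -
  let ?T = "{i \<in> I. x i \<noteq> \<zero>\<^bsub>V\<^esub>}"
  have "fsum W I (\<lambda>i. h (x i)) = (\<Oplus>\<^bsub>W\<^esub>i\<in>?T. h (x i))"
    by (rule fsum_superset[OF assms(2,5)])
      (use assms is_linear_closed[OF assms(3)] is_linear_zero[OF assms(1-3)] in auto)
  then show ?thesis using finsum_linear[OF assms(1-3,5), of x] assms(4) by (simp add: fsum_def)
qed

lemma is_linear_smult_by: "module K V \<Longrightarrow> a \<in> carrier K \<Longrightarrow> is_linear K V V (\<lambda>x. a \<odot>\<^bsub>V\<^esub> x)"
  by (rule is_linear_scale[OF _ is_linear_id])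

lemma fsum_single:
  assumes "module K V" "j \<in> I" "v \<in> carrier V"
  shows "fsum V I (\<lambda>i. if i = j then v else \<zero>\<^bsub>V\<^esub>) = v"
proof -
  interpret V: module K V by fact
  have "fsum V I (\<lambda>i. if i = j then v else \<zero>\<^bsub>V\<^esub>) = (\<Oplus>\<^bsub>V\<^esub>i\<in>{j}. if i = j then v else \<zero>\<^bsub>V\<^esub>)"
    by (rule fsum_superset) (use assms in auto)
  then show ?thesis using assms by (simp add: V.M.finsum_insert)
qed

lemma finsum_submodule:
  assumes "module K V" "submodule H K V" "finite T" "\<And>i. i \<in> T \<Longrightarrow> x i \<in> H"
  shows "(\<Oplus>\<^bsub>V\<^esub>i\<in>T. x i) \<in> H"
proof -
  interpret V: module K V by fact
  note H = submoduleD[OF assms(1,2)]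
  show ?thesis using assms(3,4)
  proof (induction T rule: finite_induct)
    case (insert i T)
    then have "x \<in> T \<rightarrow> carrier V" "x i \<in> carrier V" using H(1) by auto
    then show ?case using insert H by (simp add: V.M.finsum_insert)
  qed (use H in simp)
qed

section \<open>Quotient spaces\<close>

text \<open>
  All module axioms are identities, and pass along a surjection that respects the operations.
  This spares the quotient a separate verification of each axiom.
\<close>

lemma surjective_image_module:
  assumes "module K V" "q ` carrier V = carrier Q" "q \<zero>\<^bsub>V\<^esub> = \<zero>\<^bsub>Q\<^esub>"
    and "\<And>x y. x \<in> carrier V \<Longrightarrow> y \<in> carrier V \<Longrightarrow> q x \<oplus>\<^bsub>Q\<^esub> q y = q (x \<oplus>\<^bsub>V\<^esub> y)"
    and "\<And>a x. a \<in> carrier K \<Longrightarrow> x \<in> carrier V \<Longrightarrow> a \<odot>\<^bsub>Q\<^esub> q x = q (a \<odot>\<^bsub>V\<^esub> x)"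
  shows "module K Q" "is_linear K V Q q"
proof -
  interpret V: module K V by fact
  note ops = assms(4,5) assms(3)[symmetric]
  have all: "(\<forall>T\<in>carrier Q. P T) \<longleftrightarrow> (\<forall>x\<in>carrier V. P (q x))" for P
    unfolding assms(2)[symmetric] by blast
  have ex: "(\<exists>T\<in>carrier Q. P T) \<longleftrightarrow> (\<exists>x\<in>carrier V. P (q x))" for P
    unfolding assms(2)[symmetric] by blast
  have mem: "x \<in> carrier V \<Longrightarrow> q x \<in> carrier Q" for x using assms(2) by blast
  have "abelian_group Q"
  proof (rule abelian_groupI)
    show "\<zero>\<^bsub>Q\<^esub> \<in> carrier Q" using mem[of "\<zero>\<^bsub>V\<^esub>"] by (simp add: assms(3))
    have "\<forall>X\<in>carrier Q. \<forall>Y\<in>carrier Q. X \<oplus>\<^bsub>Q\<^esub> Y \<in> carrier Q \<and> X \<oplus>\<^bsub>Q\<^esub> Y = Y \<oplus>\<^bsub>Q\<^esub> X"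
      by (simp add: all ops mem V.M.a_comm)
    then show "\<And>X Y. X \<in> carrier Q \<Longrightarrow> Y \<in> carrier Q \<Longrightarrow> X \<oplus>\<^bsub>Q\<^esub> Y \<in> carrier Q"
      "\<And>X Y. X \<in> carrier Q \<Longrightarrow> Y \<in> carrier Q \<Longrightarrow> X \<oplus>\<^bsub>Q\<^esub> Y = Y \<oplus>\<^bsub>Q\<^esub> X" by blast+
    have "\<forall>X\<in>carrier Q. \<forall>Y\<in>carrier Q. \<forall>Z\<in>carrier Q. (X \<oplus>\<^bsub>Q\<^esub> Y) \<oplus>\<^bsub>Q\<^esub> Z = X \<oplus>\<^bsub>Q\<^esub> (Y \<oplus>\<^bsub>Q\<^esub> Z)"
      by (simp add: all ops V.M.a_assoc)
    then show "\<And>X Y Z. X \<in> carrier Q \<Longrightarrow> Y \<in> carrier Q \<Longrightarrow> Z \<in> carrier Q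
      \<Longrightarrow> (X \<oplus>\<^bsub>Q\<^esub> Y) \<oplus>\<^bsub>Q\<^esub> Z = X \<oplus>\<^bsub>Q\<^esub> (Y \<oplus>\<^bsub>Q\<^esub> Z)" by blast
    have "\<forall>X\<in>carrier Q. \<zero>\<^bsub>Q\<^esub> \<oplus>\<^bsub>Q\<^esub> X = X" by (simp add: all ops)
    then show "\<And>X. X \<in> carrier Q \<Longrightarrow> \<zero>\<^bsub>Q\<^esub> \<oplus>\<^bsub>Q\<^esub> X = X" by blast
    have "\<forall>X\<in>carrier Q. \<exists>Y\<in>carrier Q. Y \<oplus>\<^bsub>Q\<^esub> X = \<zero>\<^bsub>Q\<^esub>"
      unfolding all ex
    proof
      fix x assume "x \<in> carrier V"
      then show "\<exists>y\<in>carrier V. q y \<oplus>\<^bsub>Q\<^esub> q x = \<zero>\<^bsub>Q\<^esub>"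
        by (intro bexI[of _ "\<ominus>\<^bsub>V\<^esub> x"]) (simp_all add: ops V.M.l_neg)
    qed
    then show "\<And>X. X \<in> carrier Q \<Longrightarrow> \<exists>Y\<in>carrier Q. Y \<oplus>\<^bsub>Q\<^esub> X = \<zero>\<^bsub>Q\<^esub>" by blast
  qed
  moreover have "\<forall>X\<in>carrier Q. \<forall>a\<in>carrier K. a \<odot>\<^bsub>Q\<^esub> X \<in> carrier Q"
    by (simp add: all ops mem)
  moreover have "\<forall>X\<in>carrier Q. \<forall>a\<in>carrier K. \<forall>b\<in>carrier K.
      (a \<oplus>\<^bsub>K\<^esub> b) \<odot>\<^bsub>Q\<^esub> X = (a \<odot>\<^bsub>Q\<^esub> X) \<oplus>\<^bsub>Q\<^esub> (b \<odot>\<^bsub>Q\<^esub> X)"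
    by (simp add: all ops V.smult_l_distr)
  moreover have "\<forall>X\<in>carrier Q. \<forall>Y\<in>carrier Q. \<forall>a\<in>carrier K. 
      a \<odot>\<^bsub>Q\<^esub> (X \<oplus>\<^bsub>Q\<^esub> Y) = (a \<odot>\<^bsub>Q\<^esub> X) \<oplus>\<^bsub>Q\<^esub> (a \<odot>\<^bsub>Q\<^esub> Y)"
    by (simp add: all ops V.smult_r_distr)
  moreover have "\<forall>X\<in>carrier Q. \<forall>a\<in>carrier K. \<forall>b\<in>carrier K.
      (a \<otimes>\<^bsub>K\<^esub> b) \<odot>\<^bsub>Q\<^esub> X = a \<odot>\<^bsub>Q\<^esub> (b \<odot>\<^bsub>Q\<^esub> X)"
    by (simp add: all ops V.smult_assoc1)
  moreover have "\<forall>X\<in>carrier Q. \<one>\<^bsub>K\<^esub> \<odot>\<^bsub>Q\<^esub> X = X"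
    by (simp add: all ops)
  ultimately show "module K Q"
    by (intro moduleI V.R.is_cring) blast+
  show "is_linear K V Q q" by (rule is_linearI) (simp_all add: ops mem)
qed

lemma coset_eq_iff:
  assumes "module K V" "submodule H K V" "x \<in> carrier V" "y \<in> carrier V"
  shows "H +>\<^bsub>V\<^esub> x = H +>\<^bsub>V\<^esub> y \<longleftrightarrow> x \<ominus>\<^bsub>V\<^esub> y \<in> H"
proof -
  interpret V: module K V by fact
  have "subgroup H (add_monoid V)" by (rule submodule.axioms(1)[OF assms(2)])
  then interpret H: abelian_subgroup H V
    by (intro abelian_subgroupI3 additive_subgroupI V.M.abelian_group_axioms)
  show ?thesis
    using assms(3,4) H.a_rcos_module[of y x] H.a_rcos_self[of x] V.M.a_repr_independence[OF _ _ H.a_subgroup, of x y]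
    by (auto simp: a_minus_def)
qed

text \<open>
  The scalar multiple of a coset is defined as a union over its representatives; all of them give the
  same coset because \<open>H\<close> is closed under scalars.
\<close>

lemma quotient_space_module:
  assumes "module K V" "submodule H K V"
  shows "module K (quotient_space K V H)"
    and "is_linear K V (quotient_space K V H) (\<lambda>v. H +>\<^bsub>V\<^esub> v)"
    and "(\<lambda>v. H +>\<^bsub>V\<^esub> v) ` carrier V = carrier (quotient_space K V H)"
proof -
  interpret V: module K V by fact
  have sub: "subgroup H (add_monoid V)" by (rule submodule.axioms(1)[OF assms(2)])
  then interpret H: abelian_subgroup H V
    by (intro abelian_subgroupI3 additive_subgroupI V.M.abelian_group_axioms)
  note Hs = submoduleD[OF assms]
  show surj: "(\<lambda>v. H +>\<^bsub>V\<^esub> v) ` carrier V = carrier (quotient_space K V H)"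
    by (auto simp: quotient_space_def A_RCOSETS_def')
  have smult: "a \<odot>\<^bsub>quotient_space K V H\<^esub> (H +>\<^bsub>V\<^esub> x) = H +>\<^bsub>V\<^esub> (a \<odot>\<^bsub>V\<^esub> x)"
    if a: "a \<in> carrier K" and x: "x \<in> carrier V" for a x
  proof -
    have eq: "H +>\<^bsub>V\<^esub> (a \<odot>\<^bsub>V\<^esub> t) = H +>\<^bsub>V\<^esub> (a \<odot>\<^bsub>V\<^esub> x)" if t: "t \<in> H +>\<^bsub>V\<^esub> x" for t
    proof -
      have tV: "t \<in> carrier V" using t x V.M.a_rcosetsI[OF Hs(1) x] H.a_rcosets_part_G by blast
      have "t \<ominus>\<^bsub>V\<^esub> x \<in> H" using H.a_rcos_module[OF x tV] t by (simp add: a_minus_def)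
      then have "a \<odot>\<^bsub>V\<^esub> (t \<ominus>\<^bsub>V\<^esub> x) \<in> H" by (rule Hs(4)[OF a])
      moreover have "a \<odot>\<^bsub>V\<^esub> (t \<ominus>\<^bsub>V\<^esub> x) = (a \<odot>\<^bsub>V\<^esub> t) \<ominus>\<^bsub>V\<^esub> (a \<odot>\<^bsub>V\<^esub> x)"
        by (rule is_linear_minus[OF assms(1) assms(1) is_linear_smult_by[OF assms(1) a] tV x])
      ultimately show ?thesis 
        using coset_eq_iff[OF assms V.smult_closed[OF a tV] V.smult_closed[OF a x]] by simp
    qed
    have "x \<in> H +>\<^bsub>V\<^esub> x" by (rule H.a_rcos_self[OF x])
    then have "(\<Union>t\<in>H +>\<^bsub>V\<^esub> x. H +>\<^bsub>V\<^esub> (a \<odot>\<^bsub>V\<^esub> t)) = H +>\<^bsub>V\<^esub> (a \<odot>\<^bsub>V\<^esub> x)" using eq by blast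
    then show ?thesis by (simp add: quotient_space_def)
  qed
  have "H +>\<^bsub>V\<^esub> \<zero>\<^bsub>V\<^esub> = H" by (rule V.M.a_coset_add_zero[OF Hs(1)])
  then show "module K (quotient_space K V H)"
    "is_linear K V (quotient_space K V H) (\<lambda>v. H +>\<^bsub>V\<^esub> v)"
    using surjective_image_module[OF assms(1) surj] smult H.a_rcos_sum
    by (simp_all add: quotient_space_def)
qed

lemma quotient_universal:
  assumes "module K V" "submodule H K V" "module K W" "is_linear K V W f"
    and "\<And>x. x \<in> H \<Longrightarrow> f x = \<zero>\<^bsub>W\<^esub>"
  obtains g where "is_linear K (quotient_space K V H) W g"
    "\<And>v. v \<in> carrier V \<Longrightarrow> g (H +>\<^bsub>V\<^esub> v) = f v"
proof -
  interpret V: module K V by fact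
  interpret W: module K W by fact
  note Q = quotient_space_module[OF assms(1,2)]
  note fc = is_linear_closed[OF assms(4)]
  define g where "g T = f (SOME v. v \<in> carrier V \<and> T = H +>\<^bsub>V\<^esub> v)" for T
  have g: "g (H +>\<^bsub>V\<^esub> v) = f v" if v: "v \<in> carrier V" for v
  proof -
    let ?u = "SOME u. u \<in> carrier V \<and> H +>\<^bsub>V\<^esub> v = H +>\<^bsub>V\<^esub> u"
    have u: "?u \<in> carrier V \<and> H +>\<^bsub>V\<^esub> v = H +>\<^bsub>V\<^esub> ?u"
      by (rule someI[of _ v]) (use v in simp)
    then have "v \<ominus>\<^bsub>V\<^esub> ?u \<in> H" using coset_eq_iff[OF assms(1,2) v, of ?u] by blast
    then have "f v \<ominus>\<^bsub>W\<^esub> f ?u = \<zero>\<^bsub>W\<^esub>"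
      using is_linear_minus[OF assms(1,3,4) v, of ?u] u assms(5) by simp
    then have "f v = f ?u"
      using W.M.minus_equality[of "f v" "\<ominus>\<^bsub>W\<^esub> f ?u"] fc[OF v] fc[of ?u] u by (simp add: a_minus_def)
    then show ?thesis by (simp add: g_def)
  qed
  have all: "(\<forall>T\<in>carrier (quotient_space K V H). P T) \<longleftrightarrow> (\<forall>x\<in>carrier V. P (H +>\<^bsub>V\<^esub> x))" for P
    unfolding Q(3)[symmetric] by blast
  have "is_linear K (quotient_space K V H) W g"
    unfolding is_linear_def Pi_iff all using fc
    by (simp add: g is_linear_add[OF Q(2), symmetric] is_linear_smult[OF Q(2), symmetric]
      is_linear_add[OF assms(4)] is_linear_smult[OF assms(4)])
  then show thesis using g that by blast
qed

section \<open>Free spaces\<close>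

lemma free_space_simps:
  "f \<in> carrier (free_space K X) \<longleftrightarrow> f \<in> X \<rightarrow>\<^sub>E carrier K \<and> finite {x \<in> X. f x \<noteq> \<zero>\<^bsub>K\<^esub>}"
  "\<zero>\<^bsub>free_space K X\<^esub> = (\<lambda>x\<in>X. \<zero>\<^bsub>K\<^esub>)"
  "f \<oplus>\<^bsub>free_space K X\<^esub> g = (\<lambda>x\<in>X. f x \<oplus>\<^bsub>K\<^esub> g x)"
  "a \<odot>\<^bsub>free_space K X\<^esub> f = (\<lambda>x\<in>X. a \<otimes>\<^bsub>K\<^esub> f x)"
  by (simp_all add: free_space_def)

lemma free_space_coeff: "f \<in> carrier (free_space K X) \<Longrightarrow> x \<in> X \<Longrightarrow> f x \<in> carrier K"
  by (auto simp: free_space_simps)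

lemma free_space_module:
  assumes "cring K"
  shows "module K (free_space K X)"
proof -
  interpret K: cring K by fact
  let ?F = "free_space K X"
  have add: "f \<oplus>\<^bsub>?F\<^esub> g \<in> carrier ?F" if "f \<in> carrier ?F" "g \<in> carrier ?F" for f g
  proof -
    have "{x \<in> X. f x \<oplus>\<^bsub>K\<^esub> g x \<noteq> \<zero>\<^bsub>K\<^esub>} \<subseteq> {x \<in> X. f x \<noteq> \<zero>\<^bsub>K\<^esub>} \<union> {x \<in> X. g x \<noteq> \<zero>\<^bsub>K\<^esub>}"
      by auto
    then have "finite {x \<in> X. f x \<oplus>\<^bsub>K\<^esub> g x \<noteq> \<zero>\<^bsub>K\<^esub>}"
      using that by (auto simp: free_space_simps intro: finite_subset)
    then show ?thesis using that
      by (auto simp: free_space_simps PiE_iff cong: conj_cong)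
  qed
  have smult: "a \<odot>\<^bsub>?F\<^esub> f \<in> carrier ?F" if "a \<in> carrier K" "f \<in> carrier ?F" for a f
  proof -
    have "{x \<in> X. a \<otimes>\<^bsub>K\<^esub> f x \<noteq> \<zero>\<^bsub>K\<^esub>} \<subseteq> {x \<in> X. f x \<noteq> \<zero>\<^bsub>K\<^esub>}"
      using that(1) by auto
    then have "finite {x \<in> X. a \<otimes>\<^bsub>K\<^esub> f x \<noteq> \<zero>\<^bsub>K\<^esub>}"
      using that by (auto simp: free_space_simps intro: finite_subset)
    then show ?thesis using that
      by (auto simp: free_space_simps PiE_iff cong: conj_cong)
  qed
  have zero: "\<zero>\<^bsub>?F\<^esub> \<in> carrier ?F" by (auto simp: free_space_simps PiE_iff cong: conj_cong)
  note coeff = free_space_coeff[of _ K X]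
  have ext: "f \<in> carrier ?F \<Longrightarrow> f \<in> extensional X" for f by (auto simp: free_space_simps PiE_iff)
  have "abelian_group ?F"
  proof (rule abelian_groupI)
    fix f assume f: "f \<in> carrier ?F"
    show "\<exists>g\<in>carrier ?F. g \<oplus>\<^bsub>?F\<^esub> f = \<zero>\<^bsub>?F\<^esub>"
    proof (rule bexI[OF _ smult[OF _ f, of "\<ominus>\<^bsub>K\<^esub> \<one>\<^bsub>K\<^esub>"]])
      show "(\<ominus>\<^bsub>K\<^esub> \<one>\<^bsub>K\<^esub> \<odot>\<^bsub>?F\<^esub> f) \<oplus>\<^bsub>?F\<^esub> f = \<zero>\<^bsub>?F\<^esub>"
        by (rule extensionalityI[of _ X]) (auto simp: free_space_simps(2-) coeff[OF f] K.l_minus K.l_neg)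
    qed simp
    show "\<zero>\<^bsub>?F\<^esub> \<oplus>\<^bsub>?F\<^esub> f = f"
      by (rule extensionalityI[of _ X]) (auto simp: free_space_simps(2-) coeff f ext)
  next
    fix f g assume "f \<in> carrier ?F" "g \<in> carrier ?F"
    then show "f \<oplus>\<^bsub>?F\<^esub> g = g \<oplus>\<^bsub>?F\<^esub> f"
      by (intro extensionalityI[of _ X]) (auto simp: free_space_simps(2-) coeff K.a_comm)
  next
    fix f g h assume "f \<in> carrier ?F" "g \<in> carrier ?F" "h \<in> carrier ?F"
    then show "f \<oplus>\<^bsub>?F\<^esub> g \<oplus>\<^bsub>?F\<^esub> h = f \<oplus>\<^bsub>?F\<^esub> (g \<oplus>\<^bsub>?F\<^esub> h)"
      by (intro extensionalityI[of _ X]) (auto simp: free_space_simps(2-) coeff K.a_assoc)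
  qed (use zero add in auto)
  then show ?thesis
    by (intro moduleI assms smult; (intro extensionalityI[of _ X])?)
      (auto simp: free_space_simps(2-) coeff ext K.l_distr K.r_distr K.m_assoc)
qed

lemma basis_closed:
  assumes "cring K" "x \<in> X"
  shows "basis K X x \<in> carrier (free_space K X)"
proof -
  interpret K: cring K by fact
  have "{y \<in> X. (if y \<in> X then if y = x then \<one>\<^bsub>K\<^esub> else \<zero>\<^bsub>K\<^esub> else undefined) \<noteq> \<zero>\<^bsub>K\<^esub>} \<subseteq> {x}" by auto
  then have "finite {y \<in> X. (if y \<in> X then if y = x then \<one>\<^bsub>K\<^esub> else \<zero>\<^bsub>K\<^esub> else undefined) \<noteq> \<zero>\<^bsub>K\<^esub>}"
    by (rule finite_subset) simp
  then show ?thesis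
    by (simp add: free_space_simps basis_def)
qed

text \<open>
  Induction on a finite set containing the support, which clears one coefficient at a time.
\<close>

lemma basis_spans:
  assumes "cring K"
  shows "spans K (free_space K X) (basis K X ` X)"
  unfolding spans_def
proof (intro conjI allI impI)
  interpret K: cring K by fact
  let ?F = "free_space K X"
  note F = free_space_module[OF assms, of X]
  interpret F: module K ?F by (rule F)
  show "basis K X ` X \<subseteq> carrier ?F" using basis_closed[OF assms] by auto
  fix H assume "submodule H K ?F" and sub: "basis K X ` X \<subseteq> H"
  note H = submoduleD[OF F this(1)]
  have "f \<in> H" if "finite T" "f \<in> carrier ?F" "{x \<in> X. f x \<noteq> \<zero>\<^bsub>K\<^esub>} \<subseteq> T" for f T
    using that
  proof (induction T arbitrary: f rule: finite_induct)
    case (empty f)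
    then have "f = \<zero>\<^bsub>?F\<^esub>" by (intro extensionalityI[of _ X]) (auto simp: free_space_simps PiE_iff)
    then show ?case using H by simp
  next
    case (insert z T f)
    show ?case
    proof (cases "z \<in> X")
      case False
      then show ?thesis using insert by auto
    next
      case True
      \<comment> \<open>clearing the coefficient of \<open>z\<close> leaves an element supported in \<open>T\<close>\<close>
      let ?g = "f(z := \<zero>\<^bsub>K\<^esub>)"
      have sub': "{x \<in> X. ?g x \<noteq> \<zero>\<^bsub>K\<^esub>} \<subseteq> T" using insert(5) by auto
      have g: "?g \<in> carrier ?F"
        using insert(4) True finite_subset[OF sub' insert(1)]
        by (auto simp: free_space_simps PiE_iff extensional_def)
      have "f = ?g \<oplus>\<^bsub>?F\<^esub> (f z \<odot>\<^bsub>?F\<^esub> basis K X z)"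
        using insert(4) True
        by (intro extensionalityI[of _ X])
          (auto simp: free_space_simps PiE_iff basis_def)
      moreover have "?g \<in> H" by (rule insert(3)[OF g sub'])
      moreover have "f z \<in> carrier K" using insert(4) True by (rule free_space_coeff)
      ultimately show ?thesis using H(3,4) sub True by (metis image_subset_iff)
    qed
  qed
  then show "carrier ?F \<subseteq> H" by (auto simp: free_space_simps)
qed

text \<open>
  The extension of \<open>\<phi>\<close> is \<open>g \<mapsto> \<Sum>\<^sub>x g(x) \<phi>(x)\<close>.
\<close>

lemma free_space_universal:
  assumes "cring K" "module K W" "\<And>x. x \<in> X \<Longrightarrow> \<phi> x \<in> carrier W"
  obtains f where "is_linear K (free_space K X) W f" "\<And>x. x \<in> X \<Longrightarrow> f (basis K X x) = \<phi> x"
proof -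
  let ?F = "free_space K X"
  interpret W: module K W by fact
  define f where "f g = fsum W X (\<lambda>x. g x \<odot>\<^bsub>W\<^esub> \<phi> x)" for g
  note coeff = free_space_coeff[of _ K X]
  have fin: "finite {x \<in> X. g x \<odot>\<^bsub>W\<^esub> \<phi> x \<noteq> \<zero>\<^bsub>W\<^esub>}" if "g \<in> carrier ?F" for g
  proof (rule finite_subset)
    show "{x \<in> X. g x \<odot>\<^bsub>W\<^esub> \<phi> x \<noteq> \<zero>\<^bsub>W\<^esub>} \<subseteq> {x \<in> X. g x \<noteq> \<zero>\<^bsub>K\<^esub>}" using assms(3) by auto
  qed (use that in \<open>simp add: free_space_simps\<close>)
  have "is_linear K ?F W f"
  proof (rule is_linearI)
    fix g assume g: "g \<in> carrier ?F"
    then show "f g \<in> carrier W" unfolding f_def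
      by (intro fsum_closed[OF assms(2)] assms(3) W.smult_closed coeff)
    fix h assume h: "h \<in> carrier ?F"
    have "f (g \<oplus>\<^bsub>?F\<^esub> h) = fsum W X (\<lambda>x. (g x \<odot>\<^bsub>W\<^esub> \<phi> x) \<oplus>\<^bsub>W\<^esub> (h x \<odot>\<^bsub>W\<^esub> \<phi> x))"
      unfolding f_def
      by (rule fsum_cong[OF _ _ assms(2)]) (use g h in \<open>auto simp: free_space_simps(3) coeff assms W.smult_l_distr\<close>)
    also have "\<dots> = f g \<oplus>\<^bsub>W\<^esub> f h" unfolding f_def
      by (rule fsum_add[OF assms(2)]) (use g h fin in \<open>auto simp: coeff assms\<close>)
    finally show "f (g \<oplus>\<^bsub>?F\<^esub> h) = f g \<oplus>\<^bsub>W\<^esub> f h" .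
  next
    fix a g assume a: "a \<in> carrier K" and g: "g \<in> carrier ?F"
    have "f (a \<odot>\<^bsub>?F\<^esub> g) = fsum W X (\<lambda>x. a \<odot>\<^bsub>W\<^esub> (g x \<odot>\<^bsub>W\<^esub> \<phi> x))"
      unfolding f_def
      by (rule fsum_cong[OF _ _ assms(2)]) (use a g in \<open>auto simp: free_space_simps(4) coeff assms W.smult_assoc1\<close>)
    also have "\<dots> = a \<odot>\<^bsub>W\<^esub> f g" unfolding f_def
      by (rule fsum_linear[OF assms(2,2) is_linear_smult_by[OF assms(2) a], symmetric])
        (use g fin in \<open>auto simp: coeff assms\<close>)
    finally show "f (a \<odot>\<^bsub>?F\<^esub> g) = a \<odot>\<^bsub>W\<^esub> f g" .
  qed
  moreover have "f (basis K X x) = \<phi> x" if x: "x \<in> X" for x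
  proof -
    have "f (basis K X x) = fsum W X (\<lambda>y. if y = x then \<phi> x else \<zero>\<^bsub>W\<^esub>)"
      unfolding f_def by (rule fsum_cong[OF _ _ assms(2)]) (use assms x in \<open>auto simp: basis_def\<close>)
    then show ?thesis using fsum_single[OF assms(2) x] assms(3) x by simp
  qed
  ultimately show thesis using that by blast
qed

section \<open>Tensor products\<close>

lemma submodule_gen_submodule:
  assumes "module K V" "G \<subseteq> carrier V"
  shows "submodule (submodule_gen K V G) K V" "G \<subseteq> submodule_gen K V G"
proof -
  interpret V: module K V by fact
  show "submodule (submodule_gen K V G) K V"
  proof (rule submoduleI_add_smult[OF assms(1)])
    show "submodule_gen K V G \<subseteq> carrier V"
      using V.carrier_is_submodule assms(2) by (auto simp: submodule_gen_def)
  qed (auto simp: submodule_gen_def dest: submoduleD[OF assms(1)])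
  show "G \<subseteq> submodule_gen K V G" by (auto simp: submodule_gen_def)
qed

lemma submodule_gen_least: "submodule H K V \<Longrightarrow> G \<subseteq> H \<Longrightarrow> submodule_gen K V G \<subseteq> H"
  by (auto simp: submodule_gen_def)

definition is_bilinear where
  "is_bilinear K V W U \<beta> \<longleftrightarrow> (\<forall>w\<in>carrier W. is_linear K V U (\<lambda>v. \<beta> v w)) \<and>
     (\<forall>v\<in>carrier V. is_linear K W U (\<beta> v))"

text \<open>
  The standard facts on the quotient of the free space on \<open>V \<times> W\<close> by the bilinearity relations. Each
  relation makes one clause of bilinearity true in the quotient; conversely the linear extension of a
  bilinear map to the free space kills every relation, hence the submodule they generate.
\<close>

lemma
  assumes "module K V" "module K W"
  shows tensor_space_module: "module K (tensor_space K V W)"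
    and tens_bilinear: "is_bilinear K V W (tensor_space K V W) (tens K V W)"
    and tens_spans_all: "spans K (tensor_space K V W) {tens K V W v w | v w. v \<in> carrier V \<and> w \<in> carrier W}"
    and tensor_universal: "\<lbrakk>module K U; is_bilinear K V W U \<beta>\<rbrakk> \<Longrightarrow>
      \<exists>h. is_linear K (tensor_space K V W) U h \<and>
        (\<forall>v\<in>carrier V. \<forall>w\<in>carrier W. h (tens K V W v w) = \<beta> v w)"
proof -
  interpret V: module K V by fact
  interpret W: module K W by fact
  have K: "cring K" by (rule V.R.is_cring)
  let ?X = "carrier V \<times> carrier W"
  let ?F = "free_space K ?X"
  let ?e = "\<lambda>v w. basis K ?X (v, w)"
  let ?N = "tensor_relations K V W"
  let ?T = "tensor_space K V W"
  note F = free_space_module[OF K, of ?X]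
  interpret F: module K ?F by (rule F)
  have e: "v \<in> carrier V \<Longrightarrow> w \<in> carrier W \<Longrightarrow> ?e v w \<in> carrier ?F" for v w
    by (rule basis_closed[OF K]) simp
  define G where "G =
      {?e (v \<oplus>\<^bsub>V\<^esub> v') w \<ominus>\<^bsub>?F\<^esub> (?e v w \<oplus>\<^bsub>?F\<^esub> ?e v' w) | v v' w.
          v \<in> carrier V \<and> v' \<in> carrier V \<and> w \<in> carrier W} \<union>
       {?e v (w \<oplus>\<^bsub>W\<^esub> w') \<ominus>\<^bsub>?F\<^esub> (?e v w \<oplus>\<^bsub>?F\<^esub> ?e v w') | v w w'.
          v \<in> carrier V \<and> w \<in> carrier W \<and> w' \<in> carrier W} \<union>
       {?e (a \<odot>\<^bsub>V\<^esub> v) w \<ominus>\<^bsub>?F\<^esub> (a \<odot>\<^bsub>?F\<^esub> ?e v w) | a v w.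
          a \<in> carrier K \<and> v \<in> carrier V \<and> w \<in> carrier W} \<union>
       {?e v (a \<odot>\<^bsub>W\<^esub> w) \<ominus>\<^bsub>?F\<^esub> (a \<odot>\<^bsub>?F\<^esub> ?e v w) | a v w.
          a \<in> carrier K \<and> v \<in> carrier V \<and> w \<in> carrier W}"
  have N_eq: "?N = submodule_gen K ?F G" by (simp add: tensor_relations_def Let_def G_def)
  have GF: "G \<subseteq> carrier ?F" unfolding G_def using e by auto
  note N = submodule_gen_submodule[OF F GF, folded N_eq]
  note Q = quotient_space_module[OF F N(1), folded tensor_space_def]
  have q: "tens K V W v w = ?N +>\<^bsub>?F\<^esub> ?e v w" for v w by (simp add: tens_def)
  have eq: "?N +>\<^bsub>?F\<^esub> x = ?N +>\<^bsub>?F\<^esub> y" if "x \<ominus>\<^bsub>?F\<^esub> y \<in> G" "x \<in> carrier ?F" "y \<in> carrier ?F" for x y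
    using that coset_eq_iff[OF F N(1), of x y] N(2) by auto
  show "module K ?T" by (rule Q)
  have closed: "v \<in> carrier V \<Longrightarrow> w \<in> carrier W \<Longrightarrow> tens K V W v w \<in> carrier ?T" for v w
    unfolding q by (rule is_linear_closed[OF Q(2) e])
  show "is_bilinear K V W ?T (tens K V W)"
    unfolding is_bilinear_def
  proof (intro conjI ballI; intro is_linearI closed; assumption?)
    fix w v v' assume *: "w \<in> carrier W" "v \<in> carrier V" "v' \<in> carrier V"
    have "?N +>\<^bsub>?F\<^esub> ?e (v \<oplus>\<^bsub>V\<^esub> v') w = ?N +>\<^bsub>?F\<^esub> (?e v w \<oplus>\<^bsub>?F\<^esub> ?e v' w)"
      by (rule eq; (unfold G_def)?) (use e * in blast, use e * in auto)
    then show "tens K V W (v \<oplus>\<^bsub>V\<^esub> v') w = tens K V W v w \<oplus>\<^bsub>?T\<^esub> tens K V W v' w"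
      using * e by (simp add: q is_linear_add[OF Q(2)])
  next
    fix w v w' assume *: "w \<in> carrier W" "v \<in> carrier V" "w' \<in> carrier W"
    have "?N +>\<^bsub>?F\<^esub> ?e v (w \<oplus>\<^bsub>W\<^esub> w') = ?N +>\<^bsub>?F\<^esub> (?e v w \<oplus>\<^bsub>?F\<^esub> ?e v w')"
      by (rule eq; (unfold G_def)?) (use e * in blast, use e * in auto)
    then show "tens K V W v (w \<oplus>\<^bsub>W\<^esub> w') = tens K V W v w \<oplus>\<^bsub>?T\<^esub> tens K V W v w'"
      using * e by (simp add: q is_linear_add[OF Q(2)])
  next
    fix w v a assume *: "w \<in> carrier W" "v \<in> carrier V" "a \<in> carrier K"
    have "?N +>\<^bsub>?F\<^esub> ?e (a \<odot>\<^bsub>V\<^esub> v) w = ?N +>\<^bsub>?F\<^esub> (a \<odot>\<^bsub>?F\<^esub> ?e v w)"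
      by (rule eq; (unfold G_def)?) (use e * in blast, use e * in auto)
    then show "tens K V W (a \<odot>\<^bsub>V\<^esub> v) w = a \<odot>\<^bsub>?T\<^esub> tens K V W v w"
      using * e by (simp add: q is_linear_smult[OF Q(2)])
    have "?N +>\<^bsub>?F\<^esub> ?e v (a \<odot>\<^bsub>W\<^esub> w) = ?N +>\<^bsub>?F\<^esub> (a \<odot>\<^bsub>?F\<^esub> ?e v w)"
      by (rule eq; (unfold G_def)?) (use e * in blast, use e * in auto)
    then show "tens K V W v (a \<odot>\<^bsub>W\<^esub> w) = a \<odot>\<^bsub>?T\<^esub> tens K V W v w"
      using * e by (simp add: q is_linear_smult[OF Q(2)])
  qed
  have "spans K ?T ((\<lambda>x. ?N +>\<^bsub>?F\<^esub> x) ` basis K ?X ` ?X)"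
    by (rule spans_image[OF F Q(1-3) basis_spans[OF K]])
  also have "(\<lambda>x. ?N +>\<^bsub>?F\<^esub> x) ` basis K ?X ` ?X
      = {tens K V W v w | v w. v \<in> carrier V \<and> w \<in> carrier W}"
    by (auto simp: q)
  finally show "spans K ?T {tens K V W v w | v w. v \<in> carrier V \<and> w \<in> carrier W}" .
  assume U: "module K U" and \<beta>: "is_bilinear K V W U \<beta>"
  interpret U: module K U by (rule U)
  have \<beta>lin: "w \<in> carrier W \<Longrightarrow> is_linear K V U (\<lambda>v. \<beta> v w)" 
    "v \<in> carrier V \<Longrightarrow> is_linear K W U (\<beta> v)" for v w
    using \<beta> by (auto simp: is_bilinear_def)
  have \<beta>c: "v \<in> carrier V \<Longrightarrow> w \<in> carrier W \<Longrightarrow> \<beta> v w \<in> carrier U" for v w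
    using is_linear_closed[OF \<beta>lin(2)] .
  obtain f where f: "is_linear K ?F U f" "\<And>p. p \<in> ?X \<Longrightarrow> f (basis K ?X p) = (\<lambda>(v,w). \<beta> v w) p"
    by (rule free_space_universal[OF K U, of ?X "\<lambda>(v,w). \<beta> v w"]) (use \<beta>c in auto)
  have fe: "v \<in> carrier V \<Longrightarrow> w \<in> carrier W \<Longrightarrow> f (?e v w) = \<beta> v w" for v w using f(2) by simp
  have "submodule {x \<in> carrier ?F. f x = \<zero>\<^bsub>U\<^esub>} K ?F"
    by (rule submoduleI_add_smult[OF F])
      (auto simp: is_linear_zero[OF F U f(1)] is_linear_add[OF f(1)] is_linear_smult[OF f(1)])
  moreover have "x \<ominus>\<^bsub>U\<^esub> x = \<zero>\<^bsub>U\<^esub>" if "x \<in> carrier U" for x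
    using U.M.r_neg[OF that] by (simp add: a_minus_def)
  then have "G \<subseteq> {x \<in> carrier ?F. f x = \<zero>\<^bsub>U\<^esub>}"
    unfolding G_def using e
    by (auto simp: is_linear_minus[OF F U f(1)] is_linear_add[OF f(1)] is_linear_smult[OF f(1)] fe \<beta>c
      is_linear_add[OF \<beta>lin(1)] is_linear_add[OF \<beta>lin(2)] is_linear_smult[OF \<beta>lin(1)] is_linear_smult[OF \<beta>lin(2)])
  ultimately have "f x = \<zero>\<^bsub>U\<^esub>" if "x \<in> ?N" for x
    using submodule_gen_least[of _ K ?F G] that unfolding N_eq by blast
  then obtain h where "is_linear K ?T U h" "\<And>v. v \<in> carrier ?F \<Longrightarrow> h (?N +>\<^bsub>?F\<^esub> v) = f v"
    by (rule quotient_universal[OF F N(1) U f(1), folded tensor_space_def]) auto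
  then show "\<exists>h. is_linear K ?T U h \<and> (\<forall>v\<in>carrier V. \<forall>w\<in>carrier W. h (tens K V W v w) = \<beta> v w)"
    by (intro exI[of _ h]) (simp add: q e fe)
qed

lemma tens_closed:
  assumes "module K V" "module K W" "v \<in> carrier V" "w \<in> carrier W"
  shows "tens K V W v w \<in> carrier (tensor_space K V W)"
  using tens_bilinear[OF assms(1,2)] assms(3,4) is_linear_closed unfolding is_bilinear_def by metis

lemma tens_linear_left:
  assumes "module K V" "module K W" "w \<in> carrier W"
  shows "is_linear K V (tensor_space K V W) (\<lambda>v. tens K V W v w)"
  using tens_bilinear[OF assms(1,2)] assms(3) by (simp add: is_bilinear_def)

lemma tens_linear_right:
  assumes "module K V" "module K W" "v \<in> carrier V"
  shows "is_linear K W (tensor_space K V W) (tens K V W v)"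
  using tens_bilinear[OF assms(1,2)] assms(3) by (simp add: is_bilinear_def)

text \<open>
  Fix one factor in a generating set and let the other range over its span; then exchange
  the roles. Choosing homogeneous vectors and basis elements as generators is what reduces the
  linear axioms to computations in sets.
\<close>

lemma tens_spans:
  assumes V: "module K V" and W: "module K W" and "spans K V G" "spans K W G'"
  shows "spans K (tensor_space K V W) {tens K V W v w | v w. v \<in> G \<and> w \<in> G'}"
  unfolding spans_def
proof (intro conjI allI impI)
  have sub: "G \<subseteq> carrier V" "G' \<subseteq> carrier W" using assms by (auto simp: spans_def)
  then show "{tens K V W v w | v w. v \<in> G \<and> w \<in> G'} \<subseteq> carrier (tensor_space K V W)"
    using tens_closed[OF V W] by auto
  note T = tensor_space_module[OF V W]
  fix H assume H: "submodule H K (tensor_space K V W)"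
    and gen: "{tens K V W v w | v w. v \<in> G \<and> w \<in> G'} \<subseteq> H"
  have 1: "tens K V W v w \<in> H" if v: "v \<in> carrier V" and w: "w \<in> G'" for v w
  proof -
    have w': "w \<in> carrier W" using w sub by auto
    have "G \<subseteq> {v \<in> carrier V. tens K V W v w \<in> H}" using gen w sub by auto
    from spansD[OF assms(3) preimage_submodule[OF V T tens_linear_left[OF V W w'] H] this v]
    show ?thesis by simp
  qed
  have 2: "tens K V W v w \<in> H" if v: "v \<in> carrier V" and w: "w \<in> carrier W" for v w
  proof -
    have "G' \<subseteq> {w \<in> carrier W. tens K V W v w \<in> H}" using 1[OF v] sub by auto
    from spansD[OF assms(4) preimage_submodule[OF W T tens_linear_right[OF V W v] H] this w]
    show ?thesis by simp
  qed
  show "carrier (tensor_space K V W) \<subseteq> H"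
    using tens_spans_all[OF V W] H 2 unfolding spans_def by blast
qed

lemma tensor_eqI:
  assumes "module K V" "module K W" "module K U" "spans K V G" "spans K W G'"
    and "is_linear K (tensor_space K V W) U f" "is_linear K (tensor_space K V W) U g"
    and "\<And>v w. v \<in> G \<Longrightarrow> w \<in> G' \<Longrightarrow> f (tens K V W v w) = g (tens K V W v w)"
    and "t \<in> carrier (tensor_space K V W)"
  shows "f t = g t"
  by (rule linear_eq_on_span[OF tensor_space_module[OF assms(1,2)] assms(3,6,7) tens_spans[OF assms(1,2,4,5)]])
    (use assms(8,9) in auto)

lemma tensor_map_linear_eval:
  assumes V: "module K V" and W: "module K W" and V': "module K V'" and W': "module K W'"
    and f: "is_linear K V V' f" and g: "is_linear K W W' g"
  shows "is_linear K (tensor_space K V W) (tensor_space K V' W') (tensor_map K V W V' W' f g) \<and>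
    (\<forall>v\<in>carrier V. \<forall>w\<in>carrier W.
      tensor_map K V W V' W' f g (tens K V W v w) = tens K V' W' (f v) (g w))"
proof -
  have "is_bilinear K V W (tensor_space K V' W') (\<lambda>v w. tens K V' W' (f v) (g w))"
    unfolding is_bilinear_def
    using is_linear_comp[OF f tens_linear_left[OF V' W']] is_linear_comp[OF g tens_linear_right[OF V' W']]
      is_linear_closed[OF f] is_linear_closed[OF g] by blast
  from tensor_universal[OF V W tensor_space_module[OF V' W'] this]
  obtain h where h: "is_linear K (tensor_space K V W) (tensor_space K V' W') h"
    "\<forall>v\<in>carrier V. \<forall>w\<in>carrier W. h (tens K V W v w) = tens K V' W' (f v) (g w)" by blast
  note * = the_lin_unique[OF tensor_space_module[OF V W] tensor_space_module[OF V' W'] h(1) _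
      tens_spans_all[OF V W],
      of "\<lambda>h. \<forall>v\<in>carrier V. \<forall>w\<in>carrier W. h (tens K V W v w) = tens K V' W' (f v) (g w)",
      folded tensor_map_def]
  have "tensor_map K V W V' W' f g \<in> lin_maps K (tensor_space K V W) (tensor_space K V' W')"
    "\<forall>v\<in>carrier V. \<forall>w\<in>carrier W.
      tensor_map K V W V' W' f g (tens K V W v w) = tens K V' W' (f v) (g w)"
    by (rule *; use h(2) in \<open>auto simp: tens_closed[OF V W]\<close>)+
  then show ?thesis by (simp add: lin_maps_linear)
qed

lemmas tensor_map_linear = conjunct1[OF tensor_map_linear_eval]
lemmas tensor_map_tens = conjunct2[OF tensor_map_linear_eval, rule_format]

text \<open>
  For fixed \<open>w\<close> the map \<open>u \<otimes> v \<mapsto> u \<otimes> (v \<otimes> w)\<close> is obtained from the universal property. Its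
  linearity in \<open>w\<close> is an identity between linear maps on \<open>U \<otimes> V\<close>, so it suffices to see it on
  pure tensors; a second use of the universal property then gives the associator.
\<close>

lemma tensor_assoc_linear_eval:
  assumes U: "module K U" and V: "module K V" and W: "module K W"
  shows "is_linear K (tensor_space K (tensor_space K U V) W) (tensor_space K U (tensor_space K V W))
      (tensor_assoc K U V W) \<and>
    (\<forall>u\<in>carrier U. \<forall>v\<in>carrier V. \<forall>w\<in>carrier W.
      tensor_assoc K U V W (tens K (tensor_space K U V) W (tens K U V u v) w) =
      tens K U (tensor_space K V W) u (tens K V W v w))"
proof -
  let ?UV = "tensor_space K U V" and ?VW = "tensor_space K V W"
  let ?T = "tensor_space K U ?VW"
  note UV = tensor_space_module[OF U V] and VW = tensor_space_module[OF V W]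
  note T = tensor_space_module[OF U VW] and T' = tensor_space_module[OF UV W]
  have "\<exists>h. is_linear K ?UV ?T h \<and>
      (\<forall>u\<in>carrier U. \<forall>v\<in>carrier V. h (tens K U V u v) = tens K U ?VW u (tens K V W v w))"
    if w: "w \<in> carrier W" for w
  proof (rule tensor_universal[OF U V T])
    show "is_bilinear K U V ?T (\<lambda>u v. tens K U ?VW u (tens K V W v w))"
      unfolding is_bilinear_def
      using tens_linear_left[OF U VW tens_closed[OF V W _ w]]
        is_linear_comp[OF tens_linear_left[OF V W w] tens_linear_right[OF U VW]] by blast
  qed
  then obtain \<beta> where \<beta>: "\<And>w. w \<in> carrier W \<Longrightarrow> is_linear K ?UV ?T (\<beta> w)"
    "\<And>u v w. u \<in> carrier U \<Longrightarrow> v \<in> carrier V \<Longrightarrow> w \<in> carrier W \<Longrightarrow>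
      \<beta> w (tens K U V u v) = tens K U ?VW u (tens K V W v w)"
    by metis
  interpret W: module K W by (rule W)
  interpret T: module K ?T by (rule T)
  have lin: "is_linear K W ?T (\<lambda>w. \<beta> w t)" if t: "t \<in> carrier ?UV" for t
  proof (rule is_linearI)
    fix w w' assume *: "w \<in> carrier W" "w' \<in> carrier W"
    show "\<beta> w t \<in> carrier ?T" by (rule is_linear_closed[OF \<beta>(1)[OF *(1)] t])
    show "\<beta> (w \<oplus>\<^bsub>W\<^esub> w') t = \<beta> w t \<oplus>\<^bsub>?T\<^esub> \<beta> w' t"
      by (rule tensor_eqI[OF U V T spans_carrier spans_carrier \<beta>(1) is_linear_plus[OF T \<beta>(1) \<beta>(1)] _ t])
        (use * in \<open>simp_all add: \<beta>(2) is_linear_add[OF tens_linear_right[OF V W]]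
          is_linear_add[OF tens_linear_right[OF U VW]] tens_closed[OF V W]\<close>)
  next
    fix a w assume *: "a \<in> carrier K" "w \<in> carrier W"
    show "\<beta> (a \<odot>\<^bsub>W\<^esub> w) t = a \<odot>\<^bsub>?T\<^esub> \<beta> w t"
      by (rule tensor_eqI[OF U V T spans_carrier spans_carrier \<beta>(1) is_linear_scale[OF T \<beta>(1)] _ t])
        (use * in \<open>simp_all add: \<beta>(2) is_linear_smult[OF tens_linear_right[OF V W]]
          is_linear_smult[OF tens_linear_right[OF U VW]] tens_closed[OF V W]\<close>)
  qed
  have "is_bilinear K ?UV W ?T (\<lambda>t w. \<beta> w t)"
    using \<beta>(1) lin by (simp add: is_bilinear_def)
  from tensor_universal[OF UV W T this]
  obtain h where h: "is_linear K (tensor_space K ?UV W) ?T h"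
    "\<forall>t\<in>carrier ?UV. \<forall>w\<in>carrier W. h (tens K ?UV W t w) = \<beta> w t" by blast
  note * = the_lin_unique[OF T' T h(1) _ tens_spans[OF UV W tens_spans_all[OF U V] spans_carrier],
      of "\<lambda>h. \<forall>u\<in>carrier U. \<forall>v\<in>carrier V. \<forall>w\<in>carrier W.
        h (tens K ?UV W (tens K U V u v) w) = tens K U ?VW u (tens K V W v w)",
      folded tensor_assoc_def]
  have "tensor_assoc K U V W \<in> lin_maps K (tensor_space K ?UV W) ?T" 
    "\<forall>u\<in>carrier U. \<forall>v\<in>carrier V. \<forall>w\<in>carrier W.
        tensor_assoc K U V W (tens K ?UV W (tens K U V u v) w) = tens K U ?VW u (tens K V W v w)"
    by (rule *; use h(2) \<beta>(2) in \<open>auto simp: tens_closed U V W UV\<close>)+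
  then show ?thesis by (simp add: lin_maps_linear)
qed

lemmas tensor_assoc_linear = conjunct1[OF tensor_assoc_linear_eval]
lemmas tensor_assoc_tens = conjunct2[OF tensor_assoc_linear_eval, rule_format]

lemma tensor_assoc_inv_linear_eval:
  assumes U: "module K U" and V: "module K V" and W: "module K W"
  shows "is_linear K (tensor_space K U (tensor_space K V W)) (tensor_space K (tensor_space K U V) W)
      (tensor_assoc_inv K U V W) \<and>
    (\<forall>u\<in>carrier U. \<forall>v\<in>carrier V. \<forall>w\<in>carrier W.
      tensor_assoc_inv K U V W (tens K U (tensor_space K V W) u (tens K V W v w)) =
      tens K (tensor_space K U V) W (tens K U V u v) w)"
proof -
  let ?UV = "tensor_space K U V" and ?VW = "tensor_space K V W"
  let ?T = "tensor_space K ?UV W"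
  note UV = tensor_space_module[OF U V] and VW = tensor_space_module[OF V W]
  note T' = tensor_space_module[OF U VW] and T = tensor_space_module[OF UV W]
  have "\<exists>h. is_linear K ?VW ?T h \<and>
      (\<forall>v\<in>carrier V. \<forall>w\<in>carrier W. h (tens K V W v w) = tens K ?UV W (tens K U V u v) w)"
    if u: "u \<in> carrier U" for u
  proof (rule tensor_universal[OF V W T])
    show "is_bilinear K V W ?T (\<lambda>v w. tens K ?UV W (tens K U V u v) w)"
      unfolding is_bilinear_def
      using tens_linear_right[OF UV W tens_closed[OF U V u]]
        is_linear_comp[OF tens_linear_right[OF U V u] tens_linear_left[OF UV W]] by blast
  qed
  then obtain \<beta> where \<beta>: "\<And>u. u \<in> carrier U \<Longrightarrow> is_linear K ?VW ?T (\<beta> u)"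
    "\<And>u v w. u \<in> carrier U \<Longrightarrow> v \<in> carrier V \<Longrightarrow> w \<in> carrier W \<Longrightarrow>
      \<beta> u (tens K V W v w) = tens K ?UV W (tens K U V u v) w"
    by metis
  interpret U: module K U by (rule U)
  interpret T: module K ?T by (rule T)
  have lin: "is_linear K U ?T (\<lambda>u. \<beta> u t)" if t: "t \<in> carrier ?VW" for t
  proof (rule is_linearI)
    fix u u' assume *: "u \<in> carrier U" "u' \<in> carrier U"
    show "\<beta> u t \<in> carrier ?T" by (rule is_linear_closed[OF \<beta>(1)[OF *(1)] t])
    show "\<beta> (u \<oplus>\<^bsub>U\<^esub> u') t = \<beta> u t \<oplus>\<^bsub>?T\<^esub> \<beta> u' t"
      by (rule tensor_eqI[OF V W T spans_carrier spans_carrier \<beta>(1) is_linear_plus[OF T \<beta>(1) \<beta>(1)] _ t])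
        (use * in \<open>simp_all add: \<beta>(2) is_linear_add[OF tens_linear_left[OF U V]]
          is_linear_add[OF tens_linear_left[OF UV W]] tens_closed[OF U V]\<close>)
  next
    fix a u assume *: "a \<in> carrier K" "u \<in> carrier U"
    show "\<beta> (a \<odot>\<^bsub>U\<^esub> u) t = a \<odot>\<^bsub>?T\<^esub> \<beta> u t"
      by (rule tensor_eqI[OF V W T spans_carrier spans_carrier \<beta>(1) is_linear_scale[OF T \<beta>(1)] _ t])
        (use * in \<open>simp_all add: \<beta>(2) is_linear_smult[OF tens_linear_left[OF U V]]
          is_linear_smult[OF tens_linear_left[OF UV W]] tens_closed[OF U V]\<close>)
  qed
  have "is_bilinear K U ?VW ?T \<beta>"
    using \<beta>(1) lin by (simp add: is_bilinear_def)
  from tensor_universal[OF U VW T this]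
  obtain h where h: "is_linear K (tensor_space K U ?VW) ?T h"
    "\<forall>u\<in>carrier U. \<forall>t\<in>carrier ?VW. h (tens K U ?VW u t) = \<beta> u t" by blast
  note * = the_lin_unique[OF T' T h(1) _ tens_spans[OF U VW spans_carrier tens_spans_all[OF V W]],
      of "\<lambda>h. \<forall>u\<in>carrier U. \<forall>v\<in>carrier V. \<forall>w\<in>carrier W.
        h (tens K U ?VW u (tens K V W v w)) = tens K ?UV W (tens K U V u v) w",
      folded tensor_assoc_inv_def]
  have "tensor_assoc_inv K U V W \<in> lin_maps K (tensor_space K U ?VW) ?T" 
    "\<forall>u\<in>carrier U. \<forall>v\<in>carrier V. \<forall>w\<in>carrier W.
        tensor_assoc_inv K U V W (tens K U ?VW u (tens K V W v w)) = tens K ?UV W (tens K U V u v) w"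
    by (rule *; use h(2) \<beta>(2) in \<open>auto simp: tens_closed U V W VW\<close>)+
  then show ?thesis by (simp add: lin_maps_linear)
qed

lemmas tensor_assoc_inv_linear = conjunct1[OF tensor_assoc_inv_linear_eval]
lemmas tensor_assoc_inv_tens = conjunct2[OF tensor_assoc_inv_linear_eval, rule_format]

text \<open>
  A linear map on \<open>V \<otimes> \<Bbbk>X\<close> is the same as a family of linear maps on \<open>V\<close> indexed by \<open>X\<close>. This one
  fact yields the action \<open>V \<otimes> \<Bbbk>S \<rightarrow> V\<close>, the linearised braidings, and the projections
  \<open>V \<otimes> \<Bbbk>R \<rightarrow> V\<close> onto the coefficient of a basis element.
\<close>

lemma tensor_free_universal:
  assumes V: "module K V" and U: "module K U" and \<psi>: "\<And>x. x \<in> X \<Longrightarrow> is_linear K V U (\<psi> x)"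
  shows "\<exists>h. is_linear K (tensor_space K V (free_space K X)) U h \<and>
    (\<forall>v\<in>carrier V. \<forall>x\<in>X. h (tens K V (free_space K X) v (basis K X x)) = \<psi> x v)"
proof -
  interpret V: module K V by (rule V)
  interpret U: module K U by (rule U)
  have K: "cring K" by (rule V.R.is_cring)
  let ?F = "free_space K X"
  note F = free_space_module[OF K, of X]
  have "\<exists>f. is_linear K ?F U f \<and> (\<forall>x\<in>X. f (basis K X x) = \<psi> x v)" if v: "v \<in> carrier V" for v
    by (rule free_space_universal[OF K U, of X "\<lambda>x. \<psi> x v"]) (use is_linear_closed[OF \<psi> v] in auto)
  then obtain \<beta> where \<beta>: "\<And>v. v \<in> carrier V \<Longrightarrow> is_linear K ?F U (\<beta> v)"
    "\<And>v x. v \<in> carrier V \<Longrightarrow> x \<in> X \<Longrightarrow> \<beta> v (basis K X x) = \<psi> x v"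
    by metis
  have lin: "is_linear K V U (\<lambda>v. \<beta> v t)" if t: "t \<in> carrier ?F" for t
  proof (rule is_linearI)
    fix u u' assume *: "u \<in> carrier V" "u' \<in> carrier V"
    show "\<beta> u t \<in> carrier U" by (rule is_linear_closed[OF \<beta>(1)[OF *(1)] t])
    show "\<beta> (u \<oplus>\<^bsub>V\<^esub> u') t = \<beta> u t \<oplus>\<^bsub>U\<^esub> \<beta> u' t"
      by (rule linear_eq_on_span[OF F U \<beta>(1) is_linear_plus[OF U \<beta>(1) \<beta>(1)] basis_spans[OF K] _ t])
        (use * in \<open>auto simp: \<beta>(2) is_linear_add[OF \<psi>]\<close>)
  next
    fix a u assume *: "a \<in> carrier K" "u \<in> carrier V"
    show "\<beta> (a \<odot>\<^bsub>V\<^esub> u) t = a \<odot>\<^bsub>U\<^esub> \<beta> u t"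
      by (rule linear_eq_on_span[OF F U \<beta>(1) is_linear_scale[OF U \<beta>(1)] basis_spans[OF K] _ t])
        (use * in \<open>auto simp: \<beta>(2) is_linear_smult[OF \<psi>]\<close>)
  qed
  have "is_bilinear K V ?F U \<beta>"
    using \<beta>(1) lin by (simp add: is_bilinear_def)
  from tensor_universal[OF V F U this] obtain h where "is_linear K (tensor_space K V ?F) U h"
    "\<forall>v\<in>carrier V. \<forall>w\<in>carrier ?F. h (tens K V ?F v w) = \<beta> v w" by blast
  then show ?thesis using \<beta>(2) basis_closed[OF K, of _ X] by (intro exI[of _ h]) simp
qed

lemma linearize_map_linear_eval:
  assumes K: "cring K" and g: "g \<in> X \<times> Y \<rightarrow> Z \<times> W"
  shows "is_linear K (tensor_space K (free_space K X) (free_space K Y))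
      (tensor_space K (free_space K Z) (free_space K W)) (linearize_map K X Y Z W g) \<and>
    (\<forall>x\<in>X. \<forall>y\<in>Y. linearize_map K X Y Z W g
        (tens K (free_space K X) (free_space K Y) (basis K X x) (basis K Y y)) =
      tens K (free_space K Z) (free_space K W) (basis K Z (fst (g (x, y)))) (basis K W (snd (g (x, y)))))"
proof -
  note F = free_space_module[OF K]
  let ?T = "tensor_space K (free_space K X) (free_space K Y)"
  let ?U = "tensor_space K (free_space K Z) (free_space K W)"
  let ?b = "\<lambda>x y. tens K (free_space K X) (free_space K Y) (basis K X x) (basis K Y y)"
  let ?c = "\<lambda>x y. tens K (free_space K Z) (free_space K W)
    (basis K Z (fst (g (x, y)))) (basis K W (snd (g (x, y))))"
  note T = tensor_space_module[OF F F]
  have c: "?c x y \<in> carrier ?U" if "x \<in> X" "y \<in> Y" for x y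
  proof -
    have "g (x, y) \<in> Z \<times> W" using that g by blast
    then show ?thesis by (intro tens_closed F basis_closed K) (auto simp: mem_Times_iff)
  qed
  have "\<exists>f. is_linear K (free_space K X) ?U f \<and> (\<forall>x\<in>X. f (basis K X x) = ?c x y)" if y: "y \<in> Y" for y
    by (rule free_space_universal[OF K T, of X "\<lambda>x. ?c x y"]) (use c y in auto)
  then have "\<forall>y\<in>Y. \<exists>f. is_linear K (free_space K X) ?U f \<and> (\<forall>x\<in>X. f (basis K X x) = ?c x y)"
    by blast
  from bchoice[OF this] obtain \<psi> where \<psi>': "\<forall>y\<in>Y. is_linear K (free_space K X) ?U (\<psi> y) \<and>
      (\<forall>x\<in>X. \<psi> y (basis K X x) = ?c x y)"
    by (elim exE)
  then have \<psi>: "\<And>y. y \<in> Y \<Longrightarrow> is_linear K (free_space K X) ?U (\<psi> y)"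
    "\<And>x y. x \<in> X \<Longrightarrow> y \<in> Y \<Longrightarrow> \<psi> y (basis K X x) = ?c x y"
    by blast+
  have "\<exists>h. is_linear K ?T ?U h \<and> (\<forall>v\<in>carrier (free_space K X). \<forall>y\<in>Y.
       h (tens K (free_space K X) (free_space K Y) v (basis K Y y)) = \<psi> y v)"
    by (rule tensor_free_universal[OF F T]) (rule \<psi>(1))
  then obtain h where h: "is_linear K ?T ?U h"
    "\<forall>v\<in>carrier (free_space K X). \<forall>y\<in>Y.
       h (tens K (free_space K X) (free_space K Y) v (basis K Y y)) = \<psi> y v"
    by (elim exE conjE)
  note * = the_lin_unique[OF T T h(1) _ tens_spans[OF F F basis_spans[OF K] basis_spans[OF K]],
      of "\<lambda>h. \<forall>x\<in>X. \<forall>y\<in>Y. h (?b x y) = ?c x y"]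
  have eq: "linearize_map K X Y Z W g = the_lin K ?T ?U (\<lambda>h. \<forall>x\<in>X. \<forall>y\<in>Y. h (?b x y) = ?c x y)"
    by (simp add: linearize_map_def Let_def)
  have "linearize_map K X Y Z W g \<in> lin_maps K ?T ?U" 
    "\<forall>x\<in>X. \<forall>y\<in>Y. linearize_map K X Y Z W g (?b x y) = ?c x y"
    unfolding eq
    by (rule *; use h(2) \<psi>(2) in \<open>auto simp: tens_closed F basis_closed K\<close>)+
  then show ?thesis by (simp add: lin_maps_linear)
qed

lemmas linearize_map_linear = conjunct1[OF linearize_map_linear_eval]
lemmas linearize_map_basis = conjunct2[OF linearize_map_linear_eval, rule_format]

section \<open>Direct sum decompositions\<close>

lemma is_decomposition_fsum:
  "is_decomposition V I N m x \<longleftrightarrow> x \<in> Pi\<^sub>E I N \<and> finite {i \<in> I. x i \<noteq> \<zero>\<^bsub>V\<^esub>} \<and> m = fsum V I x"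
  by (simp add: is_decomposition_def fsum_def)

lemma direct_sum_submodule: "is_direct_sum K V I N \<Longrightarrow> i \<in> I \<Longrightarrow> submodule (N i) K V"
  by (simp add: is_direct_sum_def)

lemma components_decomposition:
  assumes "is_direct_sum K V I N" "m \<in> carrier V"
  shows "is_decomposition V I N m (components V I N m)"
proof -
  have "\<exists>!x. is_decomposition V I N m x" using assms by (simp add: is_direct_sum_def)
  then show ?thesis unfolding components_def by (rule theI')
qed

lemma components_unique:
  assumes "is_direct_sum K V I N" "m \<in> carrier V" "is_decomposition V I N m x"
  shows "components V I N m = x"
  using components_decomposition[OF assms(1,2)] assms unfolding is_direct_sum_def by blast

lemma component_mem:
  assumes "is_direct_sum K V I N" "m \<in> carrier V" "i \<in> I"
  shows "components V I N m i \<in> N i"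
  using components_decomposition[OF assms(1,2)] assms(3) by (auto simp: is_decomposition_def)

lemma component_homogeneous:
  assumes V: "module K V" and ds: "is_direct_sum K V I N" and "r \<in> I" "m \<in> N r" "i \<in> I"
  shows "components V I N m i = (if i = r then m else \<zero>\<^bsub>V\<^esub>)"
proof -
  note N = submoduleD[OF V direct_sum_submodule[OF ds]]
  have m: "m \<in> carrier V" using N(1) assms by blast
  let ?x = "\<lambda>i\<in>I. if i = r then m else \<zero>\<^bsub>V\<^esub>"
  have "finite {i \<in> I. ?x i \<noteq> \<zero>\<^bsub>V\<^esub>}" by (rule finite_subset[of _ "{r}"]) auto
  moreover have "fsum V I ?x = fsum V I (\<lambda>i. if i = r then m else \<zero>\<^bsub>V\<^esub>)"
    by (rule fsum_cong[OF _ _ V]) (use m N(1,2) assms(3) in auto)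
  ultimately have "is_decomposition V I N m ?x"
    using fsum_single[OF V assms(3) m] N(2) assms(4) by (auto simp: is_decomposition_fsum)
  from components_unique[OF ds m this] show ?thesis using assms by simp
qed

lemma homogeneous_iff_component:
  assumes "module K V" "is_direct_sum K V I N" "r \<in> I" "m \<in> carrier V"
  shows "m \<in> N r \<longleftrightarrow> components V I N m r = m"
  using component_homogeneous[OF assms(1-3), of m r] component_mem[OF assms(2,4,3)] assms(3) by auto

text \<open>
  The pointwise sum of the decompositions of \<open>m\<close> and \<open>m'\<close> is a decomposition of the sum, and
  decompositions are unique; likewise for scalar multiples.
\<close>

lemma component_linear:
  assumes V: "module K V" and ds: "is_direct_sum K V I N" and r: "r \<in> I"
  shows "is_linear K V V (\<lambda>m. components V I N m r)"
proof -
  interpret V: module K V by (rule V)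
  note N = submoduleD[OF V direct_sum_submodule[OF ds]]
  have mem: "m \<in> carrier V \<Longrightarrow> i \<in> I \<Longrightarrow> components V I N m i \<in> carrier V" for m i
    using component_mem[OF ds] N(1) by blast
  have fin: "m \<in> carrier V \<Longrightarrow> finite {i \<in> I. components V I N m i \<noteq> \<zero>\<^bsub>V\<^esub>}" for m
    using components_decomposition[OF ds] by (simp add: is_decomposition_def)
  have sum: "m \<in> carrier V \<Longrightarrow> fsum V I (components V I N m) = m" for m
    using components_decomposition[OF ds] by (simp add: is_decomposition_fsum)
  show ?thesis
  proof (rule is_linearI)
    fix m assume m: "m \<in> carrier V"
    show "components V I N m r \<in> carrier V" using mem[OF m r] .
    fix m' assume m': "m' \<in> carrier V"
    let ?x = "\<lambda>i\<in>I. components V I N m i \<oplus>\<^bsub>V\<^esub> components V I N m' i"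
    have "finite {i \<in> I. ?x i \<noteq> \<zero>\<^bsub>V\<^esub>}"
      by (rule finite_subset[OF _ finite_UnI[OF fin[OF m] fin[OF m']]]) auto
    moreover have "fsum V I ?x = fsum V I (\<lambda>i. components V I N m i \<oplus>\<^bsub>V\<^esub> components V I N m' i)"
      by (rule fsum_cong[OF _ _ V]) (use m m' mem in auto)
    moreover have "\<dots> = m \<oplus>\<^bsub>V\<^esub> m'"
      using fsum_add[OF V mem[OF m] mem[OF m'] fin[OF m] fin[OF m']] sum m m' by simp
    ultimately have "is_decomposition V I N (m \<oplus>\<^bsub>V\<^esub> m') ?x"
      using component_mem[OF ds] m m' N(3) by (auto simp: is_decomposition_fsum)
    from components_unique[OF ds V.M.a_closed[OF m m'] this]
    show "components V I N (m \<oplus>\<^bsub>V\<^esub> m') r = components V I N m r \<oplus>\<^bsub>V\<^esub> components V I N m' r"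
      using r by simp
  next
    fix a m assume a: "a \<in> carrier K" and m: "m \<in> carrier V"
    let ?x = "\<lambda>i\<in>I. a \<odot>\<^bsub>V\<^esub> components V I N m i"
    have "finite {i \<in> I. ?x i \<noteq> \<zero>\<^bsub>V\<^esub>}"
      by (rule finite_subset[OF _ fin[OF m]]) (use a in auto)
    moreover have "fsum V I ?x = fsum V I (\<lambda>i. a \<odot>\<^bsub>V\<^esub> components V I N m i)"
      by (rule fsum_cong[OF _ _ V]) (use a m mem in auto)
    moreover have "\<dots> = a \<odot>\<^bsub>V\<^esub> m"
      using fsum_linear[OF V V is_linear_smult_by[OF V a] mem[OF m] fin[OF m]] sum m by simp
    ultimately have "is_decomposition V I N (a \<odot>\<^bsub>V\<^esub> m) ?x"
      using component_mem[OF ds] a m N(4) by (auto simp: is_decomposition_fsum)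
    from components_unique[OF ds V.smult_closed[OF a m] this]
    show "components V I N (a \<odot>\<^bsub>V\<^esub> m) r = a \<odot>\<^bsub>V\<^esub> components V I N m r"
      using r by simp
  qed
qed

lemma homogeneous_spans:
  assumes V: "module K V" and ds: "is_direct_sum K V I N"
  shows "spans K V (\<Union>i\<in>I. N i)"
  unfolding spans_def
proof (intro conjI allI impI subsetI)
  fix m assume "m \<in> (\<Union>i\<in>I. N i)"
  then show "m \<in> carrier V" using submoduleD(1)[OF V direct_sum_submodule[OF ds]] by blast
next
  fix H m assume H: "submodule H K V" and sub: "(\<Union>i\<in>I. N i) \<subseteq> H" and m: "m \<in> carrier V"
  have d: "is_decomposition V I N m (components V I N m)" by (rule components_decomposition[OF ds m])
  have "fsum V I (components V I N m) \<in> H" unfolding fsum_def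
    by (rule finsum_submodule[OF V H]) (use d sub in \<open>auto simp: is_decomposition_def\<close>)
  then show "m \<in> H" using d by (simp add: is_decomposition_fsum)
qed

section \<open>The coaction of a graded space\<close>

definition grading_coaction ::
  "('k, 'i) ring_scheme \<Rightarrow> ('k, 'v) module \<Rightarrow> 'r set \<Rightarrow> ('r \<Rightarrow> 'v set) \<Rightarrow> 'v \<Rightarrow> ('v, 'r \<Rightarrow> 'k, 'k) tensor" where
  "grading_coaction K V R N = (\<lambda>m\<in>carrier V.
     \<Oplus>\<^bsub>tensor_space K V (free_space K R)\<^esub>r\<in>{r \<in> R. components V R N m r \<noteq> \<zero>\<^bsub>V\<^esub>}.
       tens K V (free_space K R) (components V R N m r) (basis K R r))"

text \<open>
  The defining sum runs over the support of \<open>m\<close>, which depends on \<open>m\<close>. Since \<open>\<zero> \<otimes> r = \<zero>\<close>, it is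
  also the sum over all of \<open>R\<close> of the linear maps \<open>m \<mapsto> m\<^sub>r \<otimes> r\<close>, and in this form linearity is
  visible.
\<close>

lemma grading_coaction_lin_maps_and_homogeneous:
  assumes V: "module K V" and ds: "is_direct_sum K V R N"
  shows "grading_coaction K V R N \<in> lin_maps K V (tensor_space K V (free_space K R)) \<and>
    (\<forall>r\<in>R. \<forall>m\<in>N r. grading_coaction K V R N m = tens K V (free_space K R) m (basis K R r))"
proof -
  interpret V: module K V by (rule V)
  have K: "cring K" by (rule V.R.is_cring)
  let ?C = "free_space K R" and ?c = "components V R N"
  note C = free_space_module[OF K, of R]
  let ?T = "tensor_space K V ?C"
  note T = tensor_space_module[OF V C]
  interpret T: module K ?T by (rule T)
  note N = submoduleD[OF V direct_sum_submodule[OF ds]]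
  have lin: "is_linear K V ?T (\<lambda>m. tens K V ?C (?c m r) (basis K R r))" if "r \<in> R" for r
    by (rule is_linear_comp[OF component_linear[OF V ds that] tens_linear_left[OF V C basis_closed[OF K that]]])
  note tc = is_linear_closed[OF lin]
  have fin: "m \<in> carrier V \<Longrightarrow> finite {r \<in> R. ?c m r \<noteq> \<zero>\<^bsub>V\<^esub>}" for m
    using components_decomposition[OF ds] by (simp add: is_decomposition_def)
  have zero: "tens K V ?C \<zero>\<^bsub>V\<^esub> (basis K R r) = \<zero>\<^bsub>?T\<^esub>" if "r \<in> R" for r
    by (rule is_linear_zero[OF V T tens_linear_left[OF V C basis_closed[OF K that]]])
  have fin': "finite {r \<in> R. tens K V ?C (?c m r) (basis K R r) \<noteq> \<zero>\<^bsub>?T\<^esub>}" if "m \<in> carrier V" for m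
    by (rule finite_subset[OF _ fin[OF that]]) (use zero in auto)
  define d where "d m = fsum ?T R (\<lambda>r. tens K V ?C (?c m r) (basis K R r))" for m
  have d: "grading_coaction K V R N m = d m" if m: "m \<in> carrier V" for m
  proof -
    have "d m = (\<Oplus>\<^bsub>?T\<^esub>r\<in>{r \<in> R. ?c m r \<noteq> \<zero>\<^bsub>V\<^esub>}. tens K V ?C (?c m r) (basis K R r))"
      unfolding d_def by (rule fsum_superset[OF T fin[OF m]]) (use tc m zero in auto)
    then show ?thesis using m by (simp add: grading_coaction_def)
  qed
  have "is_linear K V ?T d"
  proof (rule is_linearI)
    fix m assume m: "m \<in> carrier V"
    show "d m \<in> carrier ?T" unfolding d_def by (rule fsum_closed[OF T]) (use tc m in auto)
    fix m' assume m': "m' \<in> carrier V"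
    have "d (m \<oplus>\<^bsub>V\<^esub> m') = fsum ?T R (\<lambda>r. tens K V ?C (?c m r) (basis K R r) \<oplus>\<^bsub>?T\<^esub> tens K V ?C (?c m' r) (basis K R r))"
      unfolding d_def by (rule fsum_cong[OF _ _ T]) (use m m' tc is_linear_add[OF lin] in auto)
    also have "\<dots> = d m \<oplus>\<^bsub>?T\<^esub> d m'"
      unfolding d_def by (rule fsum_add[OF T tc tc fin' fin']) (use m m' in auto)
    finally show "d (m \<oplus>\<^bsub>V\<^esub> m') = d m \<oplus>\<^bsub>?T\<^esub> d m'" .
  next
    fix a m assume a: "a \<in> carrier K" and m: "m \<in> carrier V"
    have "d (a \<odot>\<^bsub>V\<^esub> m) = fsum ?T R (\<lambda>r. a \<odot>\<^bsub>?T\<^esub> tens K V ?C (?c m r) (basis K R r))"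
      unfolding d_def by (rule fsum_cong[OF _ _ T]) (use a m tc is_linear_smult[OF lin] in auto)
    also have "\<dots> = a \<odot>\<^bsub>?T\<^esub> d m" unfolding d_def
      by (rule fsum_linear[OF T T is_linear_smult_by[OF T a] tc fin', symmetric]) (use m in auto)
    finally show "d (a \<odot>\<^bsub>V\<^esub> m) = a \<odot>\<^bsub>?T\<^esub> d m" .
  qed
  then have "is_linear K V ?T (grading_coaction K V R N)"
    by (rule is_linear_cong[OF V _ d])
  then have "grading_coaction K V R N \<in> lin_maps K V ?T"
    by (simp add: lin_maps_iff grading_coaction_def)
  moreover have "grading_coaction K V R N m = tens K V ?C m (basis K R r)"
    if r: "r \<in> R" and m: "m \<in> N r" for r m
  proof -
    have mV: "m \<in> carrier V" using N(1) r m by blast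
    have tV: "tens K V ?C m (basis K R r) \<in> carrier ?T"
      by (rule tens_closed[OF V C mV basis_closed[OF K r]])
    have "d m = fsum ?T R (\<lambda>i. if i = r then tens K V ?C m (basis K R r) else \<zero>\<^bsub>?T\<^esub>)"
      unfolding d_def
      by (rule fsum_cong[OF _ _ T]) (use component_homogeneous[OF V ds r m] zero tV in auto)
    then show ?thesis using fsum_single[OF T r tV] d[OF mV] by simp
  qed
  ultimately show ?thesis by blast
qed

lemmas grading_coaction_lin_maps = conjunct1[OF grading_coaction_lin_maps_and_homogeneous]
lemmas grading_coaction_homogeneous = conjunct2[OF grading_coaction_lin_maps_and_homogeneous, rule_format]

text \<open>
  The coaction remembers the grading: the coefficient of \<open>r\<close> in \<open>\<delta> m\<close> is \<open>m\<^sub>r\<close>, and a vector is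
  homogeneous of degree \<open>r\<close> precisely if it equals its component \<open>m\<^sub>r\<close>.
\<close>

lemma homogeneous_iff_coaction:
  assumes V: "module K V" and ds: "is_direct_sum K V R N" and r: "r \<in> R" and m: "m \<in> carrier V"
  shows "m \<in> N r \<longleftrightarrow> grading_coaction K V R N m = tens K V (free_space K R) m (basis K R r)"
proof
  interpret V: module K V by (rule V)
  let ?C = "free_space K R"
  note C = free_space_module[OF V.R.is_cring, of R]
  assume eq: "grading_coaction K V R N m = tens K V ?C m (basis K R r)"
  have psi: "is_linear K V V (if x = r then (\<lambda>v. v) else (\<lambda>v. \<zero>\<^bsub>V\<^esub>))" for x
    by (simp add: is_linear_id is_linear_const_zero[OF V])
  \<comment> \<open>the projection of \<open>V \<otimes> \<Bbbk>R\<close> onto the coefficient of \<open>r\<close>\<close>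
  have "\<exists>p. is_linear K (tensor_space K V ?C) V p \<and> (\<forall>v\<in>carrier V. \<forall>x\<in>R.
      p (tens K V ?C v (basis K R x)) = (if x = r then (\<lambda>v. v) else (\<lambda>v. \<zero>\<^bsub>V\<^esub>)) v)"
    by (rule tensor_free_universal[OF V V]) (rule psi)
  then obtain p where p: "is_linear K (tensor_space K V ?C) V p"
    "\<And>v x. v \<in> carrier V \<Longrightarrow> x \<in> R \<Longrightarrow>
      p (tens K V ?C v (basis K R x)) = (if x = r then (\<lambda>v. v) else (\<lambda>v. \<zero>\<^bsub>V\<^esub>)) v"
    by auto
  have "p (grading_coaction K V R N m) = components V R N m r"
  proof (rule linear_eq_on_span[OF V V _ component_linear[OF V ds r] homogeneous_spans[OF V ds] _ m])
    show "is_linear K V V (\<lambda>m. p (grading_coaction K V R N m))"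
      by (rule is_linear_comp[OF lin_maps_linear[OF grading_coaction_lin_maps[OF V ds]] p(1)])
    fix m assume "m \<in> (\<Union>i\<in>R. N i)"
    then obtain i where i: "i \<in> R" "m \<in> N i" by blast
    then have "m \<in> carrier V" using submoduleD(1)[OF V direct_sum_submodule[OF ds]] by blast
    then show "p (grading_coaction K V R N m) = components V R N m r"
      using i r by (simp add: grading_coaction_homogeneous[OF V ds] p component_homogeneous[OF V ds i])
  qed
  then have "components V R N m r = m" using eq p(2)[OF m r] by simp
  then show "m \<in> N r" using homogeneous_iff_component[OF V ds r m] by simp
qed (rule grading_coaction_homogeneous[OF V ds r])

section \<open>The inclusion for sets\<close>

lemma set_rep_to_yd_object:
  assumes "crossed_module_of_shelves R opR S opS dot \<pi>" and M: "is_set_rep R S opS dot M"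
  shows "is_set_yd (cm_system R S opS dot) (set_rep_to_yd S M)"
proof -
  interpret crossed_module_of_shelves R opR S opS dot \<pi> by fact
  interpret M: shelf_module S opS "rep_set M" "rep_act M" using M by (simp add: is_set_rep_def)
  have gr: "m \<in> rep_set M \<Longrightarrow> rep_gr M m \<in> R" for m using M by (auto simp: is_set_rep_def)
  have gr_act: "m \<in> rep_set M \<Longrightarrow> s \<in> S \<Longrightarrow> rep_gr M (rep_act M m s) = dot (rep_gr M m) s" for m s
    using M by (auto simp: is_set_rep_def)
  show ?thesis
    unfolding is_set_yd_def Let_def set_rep_to_yd_def cm_system_def
    using gr by (auto simp: M.act_closed S.opn_closed M.act_distrib[symmetric] gr_act)
qed

lemma set_rep_to_yd_hom:
  assumes M: "is_set_rep R S opS dot M" and N: "is_set_rep R S opS dot N"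
  shows "set_yd_hom (cm_system R S opS dot) (set_rep_to_yd S M) (set_rep_to_yd S N) = set_rep_hom S M N"
  unfolding set_yd_hom_def set_rep_hom_def
  by (auto simp: set_rep_to_yd_def cm_system_def PiE_iff Pi_iff)

text \<open>
  Action and grading are extensional, so they are determined by the restricted action and by the
  second component of the coaction.
\<close>

lemma set_rep_to_yd_inj: "inj_on (set_rep_to_yd S) {M. is_set_rep R S opS dot M}"
proof (rule inj_onI)
  fix M N
  assume "M \<in> {M. is_set_rep R S opS dot M}" "N \<in> {M. is_set_rep R S opS dot M}"
    and eq: "set_rep_to_yd S M = set_rep_to_yd S N"
  then have M: "rep_act M \<in> rep_set M \<rightarrow>\<^sub>E S \<rightarrow>\<^sub>E rep_set M" "rep_gr M \<in> rep_set M \<rightarrow>\<^sub>E R"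
    and N: "rep_act N \<in> rep_set N \<rightarrow>\<^sub>E S \<rightarrow>\<^sub>E rep_set N" "rep_gr N \<in> rep_set N \<rightarrow>\<^sub>E R"
    by (auto simp: is_set_rep_def)
  have set: "rep_set M = rep_set N" using eq by (simp add: set_rep_to_yd_def)
  have act: "(\<lambda>(m, s) \<in> rep_set M \<times> S. rep_act M m s) = (\<lambda>(m, s) \<in> rep_set N \<times> S. rep_act N m s)"
    and gr: "(\<lambda>m \<in> rep_set M. (m, rep_gr M m)) = (\<lambda>m \<in> rep_set N. (m, rep_gr N m))"
    using arg_cong[OF eq, of yd_act] arg_cong[OF eq, of yd_coact]
    unfolding set_rep_to_yd_def set_yd.simps by blast+
  have "rep_act M m s = rep_act N m s" if "m \<in> rep_set N" "s \<in> S" for m s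
    using fun_cong[OF act, of "(m, s)"] that set by simp
  moreover have "rep_act M m s = rep_act N m s" if "m \<in> rep_set N" "s \<notin> S" for m s
    using M(1) N(1) that set by (auto simp: PiE_iff extensional_def)
  moreover have "rep_act M m = rep_act N m" if "m \<notin> rep_set N" for m
    using M(1) N(1) that set by (auto simp: PiE_iff extensional_def)
  ultimately have "rep_act M = rep_act N" by (metis ext)
  moreover have "rep_gr M = rep_gr N"
  proof (rule extensionalityI)
    fix m assume "m \<in> rep_set N"
    then show "rep_gr M m = rep_gr N m" using fun_cong[OF gr, of m] set by simp
  qed (use M N set in \<open>auto simp: PiE_iff\<close>)
  ultimately show "M = N" using set by simp
qed

lemma set_rep_inclusion:
  assumes "crossed_module_of_shelves R opR S opS dot \<pi>"
  shows "category_inclusion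
     (M_Set R S opS dot :: (('m, 'r, 's) set_rep, 'm \<Rightarrow> 'm) cat)
     (YD_Set (cm_system R S opS dot)) (set_rep_to_yd S) (\<lambda>M N f. f)"
proof -
  let ?B = "cm_system R S opS dot"
  have C: "category (M_Set R S opS dot :: (('m, 'r, 's) set_rep, 'm \<Rightarrow> 'm) cat)"
  proof
    fix X :: "('m, 'r, 's) set_rep" assume "X \<in> Ob (M_Set R S opS dot)"
    then have "is_set_rep R S opS dot X" by (simp add: M_Set_def)
    then interpret shelf_module S opS "rep_set X" "rep_act X" by (simp add: is_set_rep_def)
    show "Id (M_Set R S opS dot) X \<in> Hom (M_Set R S opS dot) X X"
      by (auto simp: M_Set_def set_rep_hom_def act_closed)
  next
    fix X Y Z :: "('m, 'r, 's) set_rep" and f g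
    assume "X \<in> Ob (M_Set R S opS dot)" and fg: "f \<in> Hom (M_Set R S opS dot) X Y" "g \<in> Hom (M_Set R S opS dot) Y Z"
    then have "is_set_rep R S opS dot X" by (simp add: M_Set_def)
    then interpret shelf_module S opS "rep_set X" "rep_act X" by (simp add: is_set_rep_def)
    show "Cmp (M_Set R S opS dot) X Y Z g f \<in> Hom (M_Set R S opS dot) X Z"
      using fg by (auto simp: M_Set_def set_rep_hom_def act_closed compose_def PiE_iff Pi_iff)
  qed (auto simp: M_Set_def set_rep_hom_def compose_def PiE_iff Pi_iff fun_eq_iff extensional_def)
  have D: "category (YD_Set ?B :: (('m, 's, 'r) set_yd, 'm \<Rightarrow> 'm) cat)"
  proof
    fix X :: "('m, 's, 'r) set_yd" assume "X \<in> Ob (YD_Set ?B)"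
    then have X: "yd_act X \<in> yd_set X \<times> sys_A ?B \<rightarrow>\<^sub>E yd_set X" "yd_coact X \<in> yd_set X \<rightarrow>\<^sub>E yd_set X \<times> sys_C ?B"
      by (simp_all add: YD_Set_def is_set_yd_def Let_def)
    have "map_prod (\<lambda>m\<in>yd_set X. m) id (yd_coact X m) = yd_coact X m" if "m \<in> yd_set X" for m
      using PiE_mem[OF X(2) that] by (auto simp: mem_Times_iff map_prod_def split_beta)
    then show "Id (YD_Set ?B) X \<in> Hom (YD_Set ?B) X X"
      using PiE_mem[OF X(1)] by (auto simp: YD_Set_def set_yd_hom_def)
  next
    fix X Y Z :: "('m, 's, 'r) set_yd" and f g
    assume "X \<in> Ob (YD_Set ?B)" and fg: "f \<in> Hom (YD_Set ?B) X Y" "g \<in> Hom (YD_Set ?B) Y Z"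
    then have X: "yd_act X \<in> yd_set X \<times> sys_A ?B \<rightarrow>\<^sub>E yd_set X" "yd_coact X \<in> yd_set X \<rightarrow>\<^sub>E yd_set X \<times> sys_C ?B"
      by (simp_all add: YD_Set_def is_set_yd_def Let_def)
    have "map_prod (compose (yd_set X) g f) id (yd_coact X m) = map_prod g id (map_prod f id (yd_coact X m))"
      if "m \<in> yd_set X" for m
      using PiE_mem[OF X(2) that] by (auto simp: mem_Times_iff map_prod_def split_beta compose_def)
    then show "Cmp (YD_Set ?B) X Y Z g f \<in> Hom (YD_Set ?B) X Z"
      using fg PiE_mem[OF X(1)] 
      by (auto simp: YD_Set_def set_yd_hom_def compose_def PiE_iff Pi_iff)
  qed (auto simp: YD_Set_def set_yd_hom_def compose_def PiE_iff Pi_iff fun_eq_iff extensional_def)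
  show ?thesis
  proof (intro category_inclusion.intro category_functor.intro C D category_functor_axioms.intro
        category_inclusion_axioms.intro)
    show "inj_on (set_rep_to_yd S) (Ob (M_Set R S opS dot :: (('m, 'r, 's) set_rep, 'm \<Rightarrow> 'm) cat))"
      using set_rep_to_yd_inj[of S R opS dot] by (simp add: M_Set_def)
  next
    fix X Y :: "('m, 'r, 's) set_rep"
    assume X: "X \<in> Ob (M_Set R S opS dot)"
    then show "set_rep_to_yd S X \<in> Ob (YD_Set ?B)"
      using set_rep_to_yd_object[OF assms] by (simp add: M_Set_def YD_Set_def)
    assume Y: "Y \<in> Ob (M_Set R S opS dot)"
    have hom: "Hom (YD_Set ?B) (set_rep_to_yd S X) (set_rep_to_yd S Y) = Hom (M_Set R S opS dot) X Y"
      using X Y by (simp add: M_Set_def YD_Set_def set_rep_to_yd_hom)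
    then show "f \<in> Hom (M_Set R S opS dot) X Y \<Longrightarrow> f \<in> Hom (YD_Set ?B) (set_rep_to_yd S X) (set_rep_to_yd S Y)" for f
      by simp
    show "(\<lambda>f. f) ` Hom (M_Set R S opS dot) X Y = Hom (YD_Set ?B) (set_rep_to_yd S X) (set_rep_to_yd S Y)"
      using hom by simp
  qed (auto simp: M_Set_def YD_Set_def set_rep_to_yd_def)
qed

section \<open>The inclusion for vector spaces\<close>

text \<open>
  The setting for the Yetter-Drinfel'd axioms: one linear representation of the shelf \<open>S\<close>, with
  degrees in \<open>R\<close>.
\<close>

locale linear_representation =
  fixes K :: "('k, 'i) ring_scheme" and R :: "'r set" and S :: "'s set"
    and opS :: "'s \<Rightarrow> 's \<Rightarrow> 's" and dot :: "'r \<Rightarrow> 's \<Rightarrow> 'r" and M :: "('k, 'v, 'r, 's) lin_rep"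
  assumes K: "cring K"
    and S: "shelf S opS"
    and dot: "\<And>r s. r \<in> R \<Longrightarrow> s \<in> S \<Longrightarrow> dot r s \<in> R"
    and rep: "is_lin_rep K R S opS dot M"
begin

abbreviation "V \<equiv> lrep_space M"
abbreviation "A \<equiv> free_space K S"
abbreviation "C \<equiv> free_space K R"
abbreviation "act \<equiv> lrep_act M"
abbreviation "N \<equiv> lrep_gr M"
abbreviation "\<rho> \<equiv> lyd_act (lin_rep_to_yd K R S M)"
abbreviation "\<delta> \<equiv> lyd_coact (lin_rep_to_yd K R S M)"

lemma module_V: "module K V" and vector_space_V: "is_vector_space K V"
  and act_PiE: "act \<in> carrier V \<rightarrow>\<^sub>E S \<rightarrow>\<^sub>E carrier V"
  and act_shelf: "shelf_module S opS (carrier V) act"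
  and act_lin_maps: "s \<in> S \<Longrightarrow> (\<lambda>m\<in>carrier V. act m s) \<in> lin_maps K V V"
  and gr_extensional: "N \<in> extensional R"
  and direct_sum: "is_direct_sum K V R N"
  and act_graded: "r \<in> R \<Longrightarrow> s \<in> S \<Longrightarrow> m \<in> N r \<Longrightarrow> act m s \<in> N (dot r s)"
  using rep by (auto simp: is_lin_rep_def Let_def is_vector_space_def)

lemma module_A: "module K A" and module_C: "module K C"
  by (rule free_space_module[OF K])+

lemma act_closed: "m \<in> carrier V \<Longrightarrow> s \<in> S \<Longrightarrow> act m s \<in> carrier V"
  by (rule shelf_module.act_closed[OF act_shelf])

lemma homogeneous_carrier: "r \<in> R \<Longrightarrow> m \<in> N r \<Longrightarrow> m \<in> carrier V"
  using submoduleD(1)[OF module_V direct_sum_submodule[OF direct_sum]] by blast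

lemma yd_space: "lyd_space (lin_rep_to_yd K R S M) = V"
  by (simp add: lin_rep_to_yd_def Let_def)

lemma coaction_eq: "\<delta> = grading_coaction K V R N"
  by (simp add: lin_rep_to_yd_def Let_def grading_coaction_def)

lemma coaction_lin_maps: "\<delta> \<in> lin_maps K V (tensor_space K V C)"
  unfolding coaction_eq by (rule grading_coaction_lin_maps[OF module_V direct_sum])

lemma coaction_homogeneous: "r \<in> R \<Longrightarrow> m \<in> N r \<Longrightarrow> \<delta> m = tens K V C m (basis K R r)"
  unfolding coaction_eq by (rule grading_coaction_homogeneous[OF module_V direct_sum])

lemma homogeneous_iff: "r \<in> R \<Longrightarrow> m \<in> carrier V \<Longrightarrow> m \<in> N r \<longleftrightarrow> \<delta> m = tens K V C m (basis K R r)"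
  unfolding coaction_eq by (rule homogeneous_iff_coaction[OF module_V direct_sum])

text \<open>
  The action is linear in \<open>m\<close> for each \<open>s\<close>, which is exactly the data of a linear map on
  \<open>V \<otimes> \<Bbbk>S\<close>.
\<close>

lemma action_lin_maps_and_tens:
  "\<rho> \<in> lin_maps K (tensor_space K V A) V \<and>
   (\<forall>m\<in>carrier V. \<forall>s\<in>S. \<rho> (tens K V A m (basis K S s)) = act m s)"
proof -
  let ?P = "\<lambda>h. \<forall>m\<in>carrier V. \<forall>s\<in>S. h (tens K V A m (basis K S s)) = act m s"
  have eq: "\<rho> = the_lin K (tensor_space K V A) V ?P"
    by (simp add: lin_rep_to_yd_def Let_def)
  have "\<exists>h. is_linear K (tensor_space K V A) V h \<and> (\<forall>m\<in>carrier V. \<forall>s\<in>S.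
      h (tens K V A m (basis K S s)) = (\<lambda>m\<in>carrier V. act m s) m)"
    by (rule tensor_free_universal[OF module_V module_V]) (rule lin_maps_linear[OF act_lin_maps])
  then obtain h where h: "is_linear K (tensor_space K V A) V h"
    "\<forall>m\<in>carrier V. \<forall>s\<in>S. h (tens K V A m (basis K S s)) = (\<lambda>m\<in>carrier V. act m s) m"
    by (elim exE conjE)
  note * = the_lin_unique[OF tensor_space_module[OF module_V module_A] module_V h(1) _
      tens_spans[OF module_V module_A spans_carrier basis_spans[OF K]], of ?P, folded eq]
  have "?P (restrict h (carrier (tensor_space K V A)))"
    using h(2) by (simp add: tens_closed[OF module_V module_A] basis_closed[OF K])
  from *[OF this] show ?thesis by fastforce
qed

lemmas action_lin_maps = conjunct1[OF action_lin_maps_and_tens]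
lemmas action_tens = conjunct2[OF action_lin_maps_and_tens, rule_format]

text \<open>
  On \<open>(m \<otimes> s) \<otimes> s'\<close> both sides are an iterated action, and the claim is
  \<open>(m s) s' = (m s') (s \<lhd> s')\<close>.
\<close>

lemma yd_action_axiom:
  fixes B defines "B \<equiv> linearize_system K (cm_system R S opS dot)"
  assumes "t \<in> carrier (tensor_space K (tensor_space K V A) A)"
  shows "\<rho> (tensor_map K (tensor_space K V A) A V A \<rho> (id_on A) t) =
    \<rho> (tensor_map K (tensor_space K V A) A V A \<rho> (id_on A)
      (tensor_assoc_inv K V A A
        (tensor_map K V (tensor_space K A A) V (tensor_space K A A) (id_on V) (lsig_AA B)
          (tensor_assoc K V A A t))))"
proof -
  interpret S: shelf S opS by (rule S)
  note V = module_V and A = module_A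
  note VA = tensor_space_module[OF V A] and AA = tensor_space_module[OF A A]
  let ?g = "\<lambda>(s, s'). (s', opS s s')"
  have sig: "lsig_AA B = linearize_map K S S S S ?g"
    by (simp add: B_def linearize_system_def cm_system_def)
  have g: "?g \<in> S \<times> S \<rightarrow> S \<times> S" using S.opn_closed by auto
  note \<sigma> = linearize_map_linear[OF K g, folded sig] linearize_map_basis[OF K g, folded sig]
  note \<rho> = lin_maps_linear[OF action_lin_maps]
  note idA = is_linear_id_on[OF A] and idV = is_linear_id_on[OF V]
  note closed = tens_closed[OF V A] tens_closed[OF A A] basis_closed[OF K] act_closed S.opn_closed
  note evals = tensor_map_tens[OF VA A V A \<rho> idA] tensor_assoc_tens[OF V A A]
    tensor_assoc_inv_tens[OF V A A] tensor_map_tens[OF V AA V AA idV \<sigma>(1)] \<sigma>(2) action_tens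
  show ?thesis
  proof (rule linear_eq_on_span[OF tensor_space_module[OF VA A] V
        is_linear_comp[OF tensor_map_linear[OF VA A V A \<rho> idA] \<rho>]
        is_linear_comp[OF is_linear_comp[OF is_linear_comp[OF is_linear_comp[OF
          tensor_assoc_linear[OF V A A] tensor_map_linear[OF V AA V AA idV \<sigma>(1)]]
          tensor_assoc_inv_linear[OF V A A]] tensor_map_linear[OF VA A V A \<rho> idA]] \<rho>]
        tens_spans[OF VA A tens_spans[OF V A spans_carrier basis_spans[OF K]] basis_spans[OF K]]
        _ assms(2)], clarify)
    fix m s s' assume "m \<in> carrier V" "s \<in> S" "s' \<in> S"
    then show "\<rho> (tensor_map K (tensor_space K V A) A V A \<rho> (id_on A)
          (tens K (tensor_space K V A) A (tens K V A m (basis K S s)) (basis K S s'))) =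
        \<rho> (tensor_map K (tensor_space K V A) A V A \<rho> (id_on A)
          (tensor_assoc_inv K V A A
            (tensor_map K V (tensor_space K A A) V (tensor_space K A A) (id_on V) (lsig_AA B)
              (tensor_assoc K V A A
                (tens K (tensor_space K V A) A (tens K V A m (basis K S s)) (basis K S s'))))))"
      by (simp add: evals closed shelf_module.act_distrib[OF act_shelf, symmetric])
  qed
qed

text \<open>
  For \<open>m\<close> of degree \<open>r\<close> both sides are \<open>(m \<otimes> r) \<otimes> r\<close>, since the braiding of \<open>R\<close> fixes \<open>r \<otimes> r\<close>.
\<close>

lemma yd_coaction_axiom:
  fixes B defines "B \<equiv> linearize_system K (cm_system R S opS dot)"
  assumes "m \<in> carrier V"
  shows "tensor_map K V C (tensor_space K V C) C \<delta> (id_on C) (\<delta> m) =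
    tensor_assoc_inv K V C C
      (tensor_map K V (tensor_space K C C) V (tensor_space K C C) (id_on V) (lsig_CC B)
        (tensor_assoc K V C C (tensor_map K V C (tensor_space K V C) C \<delta> (id_on C) (\<delta> m))))"
proof -
  note V = module_V and C = module_C
  note VC = tensor_space_module[OF V C] and CC = tensor_space_module[OF C C]
  let ?g = "\<lambda>(r :: 'r, r'). (r', r')"
  have sig: "lsig_CC B = linearize_map K R R R R ?g"
    by (simp add: B_def linearize_system_def cm_system_def)
  have g: "?g \<in> R \<times> R \<rightarrow> R \<times> R" by auto
  note \<sigma> = linearize_map_linear[OF K g, folded sig] linearize_map_basis[OF K g, folded sig]
  note \<delta> = lin_maps_linear[OF coaction_lin_maps]
  note idC = is_linear_id_on[OF C] and idV = is_linear_id_on[OF V]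
  note closed = tens_closed[OF V C] tens_closed[OF C C] basis_closed[OF K]
  note evals = tensor_map_tens[OF V C VC C \<delta> idC] tensor_assoc_tens[OF V C C]
    tensor_assoc_inv_tens[OF V C C] tensor_map_tens[OF V CC V CC idV \<sigma>(1)] \<sigma>(2) coaction_homogeneous
  note \<delta>\<delta> = is_linear_comp[OF \<delta> tensor_map_linear[OF V C VC C \<delta> idC]]
  show ?thesis
  proof (rule linear_eq_on_span[OF V tensor_space_module[OF VC C] \<delta>\<delta>
        is_linear_comp[OF is_linear_comp[OF is_linear_comp[OF \<delta>\<delta>
          tensor_assoc_linear[OF V C C]] tensor_map_linear[OF V CC V CC idV \<sigma>(1)]]
          tensor_assoc_inv_linear[OF V C C]]
        homogeneous_spans[OF V direct_sum] _ assms(2)], clarify)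
    fix m r assume "r \<in> R" "m \<in> N r"
    then show "tensor_map K V C (tensor_space K V C) C \<delta> (id_on C) (\<delta> m) =
      tensor_assoc_inv K V C C
        (tensor_map K V (tensor_space K C C) V (tensor_space K C C) (id_on V) (lsig_CC B)
          (tensor_assoc K V C C (tensor_map K V C (tensor_space K V C) C \<delta> (id_on C) (\<delta> m))))"
      by (simp add: evals closed homogeneous_carrier)
  qed
qed

text \<open>
  For \<open>m\<close> of degree \<open>r\<close> the right-hand side on \<open>m \<otimes> s\<close> is \<open>m s \<otimes> (r \<cdot> s)\<close>; it is the coaction of
  \<open>m s\<close> because \<open>m s\<close> has degree \<open>r \<cdot> s\<close>.
\<close>

lemma yd_compatibility_axiom:
  fixes B defines "B \<equiv> linearize_system K (cm_system R S opS dot)"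
  assumes "t \<in> carrier (tensor_space K V A)"
  shows "\<delta> (\<rho> t) =
    tensor_map K (tensor_space K V A) C V C \<rho> (id_on C)
      (tensor_assoc_inv K V A C
        (tensor_map K V (tensor_space K C A) V (tensor_space K A C) (id_on V) (lsig_CA B)
          (tensor_assoc K V C A
            (tensor_map K V A (tensor_space K V C) A \<delta> (id_on A) t))))"
proof -
  note V = module_V and C = module_C and A = module_A
  note VC = tensor_space_module[OF V C] and CA = tensor_space_module[OF C A]
    and AC = tensor_space_module[OF A C] and VA = tensor_space_module[OF V A]
  let ?g = "\<lambda>(r, s). (s, dot r s)"
  have sig: "lsig_CA B = linearize_map K R S S R ?g"
    by (simp add: B_def linearize_system_def cm_system_def)
  have g: "?g \<in> R \<times> S \<rightarrow> S \<times> R" using dot by auto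
  note \<sigma> = linearize_map_linear[OF K g, folded sig] linearize_map_basis[OF K g, folded sig]
  note \<delta> = lin_maps_linear[OF coaction_lin_maps]
  note \<rho> = lin_maps_linear[OF action_lin_maps]
  note idC = is_linear_id_on[OF C] and idA = is_linear_id_on[OF A] and idV = is_linear_id_on[OF V]
  note closed = tens_closed[OF V C] tens_closed[OF C A] tens_closed[OF A C] tens_closed[OF V A]
    basis_closed[OF K] act_closed
  note evals = tensor_map_tens[OF V A VC A \<delta> idA] tensor_assoc_tens[OF V C A]
    tensor_assoc_inv_tens[OF V A C] tensor_map_tens[OF V CA V AC idV \<sigma>(1)] \<sigma>(2)
    tensor_map_tens[OF VA C V C \<rho> idC] coaction_homogeneous action_tens
  show ?thesis
  proof (rule linear_eq_on_span[OF VA VC is_linear_comp[OF \<rho> \<delta>]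
        is_linear_comp[OF is_linear_comp[OF is_linear_comp[OF is_linear_comp[OF
          tensor_map_linear[OF V A VC A \<delta> idA] tensor_assoc_linear[OF V C A]]
          tensor_map_linear[OF V CA V AC idV \<sigma>(1)]] tensor_assoc_inv_linear[OF V A C]]
          tensor_map_linear[OF VA C V C \<rho> idC]]
        tens_spans[OF V A homogeneous_spans[OF V direct_sum] basis_spans[OF K]] _ assms(2)], clarify)
    fix m r s assume *: "r \<in> R" "m \<in> N r" "s \<in> S"
    then show "\<delta> (\<rho> (tens K V A m (basis K S s))) =
      tensor_map K (tensor_space K V A) C V C \<rho> (id_on C)
        (tensor_assoc_inv K V A C
          (tensor_map K V (tensor_space K C A) V (tensor_space K A C) (id_on V) (lsig_CA B)
            (tensor_assoc K V C A
              (tensor_map K V A (tensor_space K V C) A \<delta> (id_on A) (tens K V A m (basis K S s))))))"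
      using homogeneous_carrier[OF *(1,2)] coaction_homogeneous[OF dot[OF *(1,3)] act_graded[OF *(1,3,2)]] dot
      by (simp add: evals closed)
  qed
qed

lemma yd_object:
  "is_lin_yd K (linearize_system K (cm_system R S opS dot)) (lin_rep_to_yd K R S M)"
  using vector_space_V action_lin_maps coaction_lin_maps
    yd_action_axiom yd_coaction_axiom yd_compatibility_axiom
  by (simp add: is_lin_yd_def Let_def yd_space linearize_system_def cm_system_def)

end

text \<open>
  Commuting with the two actions can be tested on the tensors \<open>m \<otimes> s\<close>. As for the coactions, if \<open>f\<close>
  preserves degrees then \<open>\<delta> (f m) = f m \<otimes> r = (f \<otimes> \<Bbbk>R) (\<delta> m)\<close> for \<open>m\<close> of degree \<open>r\<close>, and homogeneous
  vectors span; conversely this equation says that \<open>f m\<close> has degree \<open>r\<close>.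
\<close>

lemma lin_rep_to_yd_hom:
  fixes M M' :: "('k, 'v, 'r, 's) lin_rep"
  assumes "linear_representation K R S opS dot M" "linear_representation K R S opS dot M'"
  shows "lin_yd_hom K (linearize_system K (cm_system R S opS dot))
      (lin_rep_to_yd K R S M) (lin_rep_to_yd K R S M') = lin_rep_hom K R S M M'"
    (is "?Y = ?H")
proof -
  interpret M: linear_representation K R S opS dot M by fact
  interpret M': linear_representation K R S opS dot M' by fact
  let ?A = "free_space K S" and ?C = "free_space K R"
  note A = M.module_A and C = M.module_C
  note idA = is_linear_id_on[OF A] and idC = is_linear_id_on[OF C]
  note K = M.K
  have fields: "lsys_A (linearize_system K (cm_system R S opS dot)) = ?A"
    "lsys_C (linearize_system K (cm_system R S opS dot)) = ?C"
    by (simp_all add: linearize_system_def cm_system_def)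
  have actions: "(\<forall>t\<in>carrier (tensor_space K M.V ?A).
        f (M.\<rho> t) = M'.\<rho> (tensor_map K M.V ?A M'.V ?A f (id_on ?A) t)) \<longleftrightarrow>
      (\<forall>m\<in>carrier M.V. \<forall>s\<in>S. f (M.act m s) = M'.act (f m) s)" (is "?l \<longleftrightarrow> ?r")
    if f: "is_linear K M.V M'.V f" for f
  proof -
    note fc = is_linear_closed[OF f]
    note map = tensor_map_tens[OF M.module_V A M'.module_V A f idA]
    have gen: "f (M.\<rho> (tens K M.V ?A m (basis K S s))) = f (M.act m s)"
      "M'.\<rho> (tensor_map K M.V ?A M'.V ?A f (id_on ?A) (tens K M.V ?A m (basis K S s))) = M'.act (f m) s"
      if "m \<in> carrier M.V" "s \<in> S" for m s
      using that fc by (simp_all add: map basis_closed[OF K] M.action_tens M'.action_tens)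
    show ?thesis
    proof
      assume ?l
      then show ?r using gen tens_closed[OF M.module_V A _ basis_closed[OF K]] by metis
    next
      assume r: ?r
      show ?l
      proof
        fix t assume t: "t \<in> carrier (tensor_space K M.V ?A)"
        show "f (M.\<rho> t) = M'.\<rho> (tensor_map K M.V ?A M'.V ?A f (id_on ?A) t)"
          by (rule tensor_eqI[OF M.module_V A M'.module_V spans_carrier basis_spans[OF K]
                is_linear_comp[OF lin_maps_linear[OF M.action_lin_maps] f]
                is_linear_comp[OF tensor_map_linear[OF M.module_V A M'.module_V A f idA]
                  lin_maps_linear[OF M'.action_lin_maps]] _ t])
            (use r gen in auto)
      qed
    qed
  qed
  have coactions: "(\<forall>m\<in>carrier M.V. M'.\<delta> (f m) = tensor_map K M.V ?C M'.V ?C f (id_on ?C) (M.\<delta> m)) \<longleftrightarrow>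
      (\<forall>r\<in>R. f ` M.N r \<subseteq> M'.N r)" (is "?l \<longleftrightarrow> ?r")
    if f: "is_linear K M.V M'.V f" for f
  proof -
    note fc = is_linear_closed[OF f]
    note map = tensor_map_tens[OF M.module_V C M'.module_V C f idC]
    have gen: "tensor_map K M.V ?C M'.V ?C f (id_on ?C) (M.\<delta> m) = tens K M'.V ?C (f m) (basis K R r)"
      if "r \<in> R" "m \<in> M.N r" for m r
      using M.homogeneous_carrier[OF that] M.coaction_homogeneous[OF that] that(1)
      by (simp add: map basis_closed[OF K])
    show ?thesis
    proof
      assume l: ?l
      show ?r
      proof (intro ballI image_subsetI)
        fix r m assume rm: "r \<in> R" "m \<in> M.N r"
        then have m: "m \<in> carrier M.V" by (rule M.homogeneous_carrier)
        show "f m \<in> M'.N r" using l m gen[OF rm] M'.homogeneous_iff[OF rm(1) fc[OF m]] by simp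
      qed
    next
      assume r: ?r
      show ?l
      proof
        fix m assume m: "m \<in> carrier M.V"
        show "M'.\<delta> (f m) = tensor_map K M.V ?C M'.V ?C f (id_on ?C) (M.\<delta> m)"
        proof (rule linear_eq_on_span[OF M.module_V tensor_space_module[OF M'.module_V C]
              is_linear_comp[OF f lin_maps_linear[OF M'.coaction_lin_maps]]
              is_linear_comp[OF lin_maps_linear[OF M.coaction_lin_maps]
                tensor_map_linear[OF M.module_V C M'.module_V C f idC]]
              homogeneous_spans[OF M.module_V M.direct_sum] _ m], clarify)
          fix m r assume rm: "r \<in> R" "m \<in> M.N r"
          then have "f m \<in> M'.N r" using r by blast
          then show "M'.\<delta> (f m) = tensor_map K M.V ?C M'.V ?C f (id_on ?C) (M.\<delta> m)"
            using M'.coaction_homogeneous[OF rm(1)] gen[OF rm] by simp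
        qed
      qed
    qed
  qed
  show ?thesis
    unfolding lin_yd_hom_def lin_rep_hom_def Let_def fields M.yd_space M'.yd_space
    by (intro Collect_cong conj_cong refl actions coactions lin_maps_linear)
qed

lemma lin_rep_to_yd_inj:
  fixes M M' :: "('k, 'v, 'r, 's) lin_rep"
  assumes "linear_representation K R S opS dot M" "linear_representation K R S opS dot M'"
    and eq: "lin_rep_to_yd K R S M = lin_rep_to_yd K R S M'"
  shows "M = M'"
proof -
  interpret M: linear_representation K R S opS dot M by fact
  interpret M': linear_representation K R S opS dot M' by fact
  have V: "M.V = M'.V" using M.yd_space M'.yd_space eq by simp
  have "M.act m s = M'.act m s" if "m \<in> carrier M.V" "s \<in> S" for m s
    using M.action_tens[OF that] M'.action_tens[of m s] that V eq by simp
  moreover have "M.act m s = M'.act m s" if "m \<in> carrier M.V" "s \<notin> S" for m s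
    using M.act_PiE M'.act_PiE that V by (auto simp: PiE_iff extensional_def)
  moreover have "M.act m = M'.act m" if "m \<notin> carrier M.V" for m
    using M.act_PiE M'.act_PiE that V by (auto simp: PiE_iff extensional_def)
  ultimately have "M.act = M'.act" by (metis ext)
  moreover have "M.N = M'.N"
  proof (rule extensionalityI)
    fix r assume r: "r \<in> R"
    have "m \<in> M.N r \<longleftrightarrow> m \<in> M'.N r" if "m \<in> carrier M.V" for m
      using M.homogeneous_iff[OF r that] M'.homogeneous_iff[OF r, of m] that V eq by simp
    then show "M.N r = M'.N r"
      using M.homogeneous_carrier[OF r] M'.homogeneous_carrier[OF r] V by auto
  qed (rule M.gr_extensional M'.gr_extensional)+
  ultimately show ?thesis using V by simp
qed

lemma lin_maps_compose:
  assumes "module K U" "f \<in> lin_maps K U V" "g \<in> lin_maps K V W"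
  shows "compose (carrier U) g f \<in> lin_maps K U W"
  using restrict_lin_maps[OF assms(1) is_linear_comp[OF lin_maps_linear[OF assms(2)] lin_maps_linear[OF assms(3)]]]
  by (simp add: compose_def)

lemma M_Lin_category:
  assumes "\<And>r s. r \<in> R \<Longrightarrow> s \<in> S \<Longrightarrow> dot r s \<in> R"
  shows "category (M_Lin K R S opS dot :: (('k, 'v, 'r, 's) lin_rep, 'v \<Rightarrow> 'v) cat)"
proof
  note defs = M_Lin_def lin_rep_hom_def
  let ?C = "M_Lin K R S opS dot :: (('k, 'v, 'r, 's) lin_rep, 'v \<Rightarrow> 'v) cat"
  have ob: "module K (lrep_space X)" "shelf_module S opS (carrier (lrep_space X)) (lrep_act X)"
    "\<And>r. r \<in> R \<Longrightarrow> lrep_gr X r \<subseteq> carrier (lrep_space X)"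
    if "X \<in> Ob ?C" for X
    using that direct_sum_submodule[THEN submoduleD(1)[rotated], of K "lrep_space X" R "lrep_gr X"]
    by (auto simp: defs is_lin_rep_def Let_def is_vector_space_def)
  fix X assume X: "X \<in> Ob ?C"
  note act = shelf_module.act_closed[OF ob(2)[OF X]]
  show "Id ?C X \<in> Hom ?C X X"
    using restrict_lin_maps[OF ob(1)[OF X] is_linear_id] act ob(3)[OF X] by (auto simp: defs)
  fix Y assume Y: "Y \<in> Ob ?C"
  {
    fix f assume "f \<in> Hom ?C X Y"
    then show "Cmp ?C X Y Y (Id ?C Y) f = f" "Cmp ?C X X Y f (Id ?C X) = f"
      by (auto simp: defs lin_maps_def compose_def PiE_iff Pi_iff fun_eq_iff extensional_def)
  }
  fix Z f g assume Z: "Z \<in> Ob ?C" and f: "f \<in> Hom ?C X Y" and g: "g \<in> Hom ?C Y Z"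
  have fc: "m \<in> carrier (lrep_space X) \<Longrightarrow> f m \<in> carrier (lrep_space Y)" for m
    using f by (auto simp: defs lin_maps_def)
  have "g (f m) \<in> lrep_gr Z r" if "r \<in> R" "m \<in> lrep_gr X r" for r m
  proof -
    have "f ` lrep_gr X r \<subseteq> lrep_gr Y r" "g ` lrep_gr Y r \<subseteq> lrep_gr Z r"
      using f g that(1) by (simp_all add: defs)
    then show ?thesis using that(2) by blast
  qed
  then show "Cmp ?C X Y Z g f \<in> Hom ?C X Z"
    using f g act ob(3)[OF X] fc lin_maps_compose[OF ob(1)[OF X]]
    by (auto simp: defs compose_def subset_iff)
next
  let ?C = "M_Lin K R S opS dot :: (('k, 'v, 'r, 's) lin_rep, 'v \<Rightarrow> 'v) cat"
  fix W X Y Z f g h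
  assume "f \<in> Hom ?C W X"
  then have "f \<in> carrier (lrep_space W) \<rightarrow> carrier (lrep_space X)"
    by (auto simp: M_Lin_def lin_rep_hom_def lin_maps_def)
  then show "Cmp ?C W X Z (Cmp ?C X Y Z h g) f = Cmp ?C W Y Z h (Cmp ?C W X Y g f)"
    by (simp add: M_Lin_def compose_assoc)
qed

lemma tensor_map_id:
  assumes "module K V" "module K A" "t \<in> carrier (tensor_space K V A)"
  shows "tensor_map K V A V A (id_on V) (id_on A) t = t"
  by (rule tensor_eqI[OF assms(1,2) tensor_space_module[OF assms(1,2)] spans_carrier spans_carrier
      tensor_map_linear[OF assms(1,2,1,2) is_linear_id_on is_linear_id_on] is_linear_id _ assms(3)])
    (simp_all add: assms tensor_map_tens is_linear_id_on)

lemma tensor_map_compose: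
  assumes "module K U" "module K V" "module K W" "module K A"
    and f: "is_linear K U V f" and g: "is_linear K V W g" and "t \<in> carrier (tensor_space K U A)"
  shows "tensor_map K U A W A (compose (carrier U) g f) (id_on A) t =
    tensor_map K V A W A g (id_on A) (tensor_map K U A V A f (id_on A) t)"
proof -
  note id = is_linear_id_on[OF assms(4)]
  have gf: "is_linear K U W (compose (carrier U) g f)"
    by (rule is_linear_cong[OF assms(1) is_linear_comp[OF f g]]) (simp add: compose_def)
  show ?thesis
    by (rule tensor_eqI[OF assms(1,4) tensor_space_module[OF assms(3,4)] spans_carrier spans_carrier
          tensor_map_linear[OF assms(1,4,3,4) gf id]
          is_linear_comp[OF tensor_map_linear[OF assms(1,4,2,4) f id] tensor_map_linear[OF assms(2,4,3,4) g id]] _ assms(7)])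
      (simp_all add: tensor_map_tens[OF assms(1,4,3,4) gf id] tensor_map_tens[OF assms(1,4,2,4) f id]
        tensor_map_tens[OF assms(2,4,3,4) g id] is_linear_closed[OF f] compose_eq)
qed

text \<open>
  Identities and composites are morphisms because tensoring with a fixed factor is functorial.
\<close>

lemma YD_Lin_category:
  fixes B :: "('k, 'a, 'c) lin_system"
  assumes A: "module K (lsys_A B)" and C: "module K (lsys_C B)"
  shows "category (YD_Lin K B :: (('k, 'v, 'a, 'c) lin_yd, 'v \<Rightarrow> 'v) cat)"
proof
  note defs = YD_Lin_def lin_yd_hom_def Let_def
  let ?C = "YD_Lin K B :: (('k, 'v, 'a, 'c) lin_yd, 'v \<Rightarrow> 'v) cat"
  have ob: "module K (lyd_space X)"
    "lyd_act X \<in> lin_maps K (tensor_space K (lyd_space X) (lsys_A B)) (lyd_space X)"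
    "lyd_coact X \<in> lin_maps K (lyd_space X) (tensor_space K (lyd_space X) (lsys_C B))"
    if "X \<in> Ob ?C" for X
    using that by (simp_all add: defs is_lin_yd_def is_vector_space_def)
  fix X assume X: "X \<in> Ob ?C"
  note act = is_linear_closed[OF lin_maps_linear[OF ob(2)[OF X]]]
  note coact = is_linear_closed[OF lin_maps_linear[OF ob(3)[OF X]]]
  show "Id ?C X \<in> Hom ?C X X"
    using restrict_lin_maps[OF ob(1)[OF X] is_linear_id] act coact
    by (simp add: defs tensor_map_id[OF ob(1)[OF X] A] tensor_map_id[OF ob(1)[OF X] C])
  fix Y assume Y: "Y \<in> Ob ?C"
  {
    fix f assume "f \<in> Hom ?C X Y"
    then show "Cmp ?C X Y Y (Id ?C Y) f = f" "Cmp ?C X X Y f (Id ?C X) = f"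
      by (auto simp: defs lin_maps_def compose_def PiE_iff Pi_iff fun_eq_iff extensional_def)
  }
  fix Z f g assume Z: "Z \<in> Ob ?C" and f: "f \<in> Hom ?C X Y" and g: "g \<in> Hom ?C Y Z"
  have lin: "f \<in> lin_maps K (lyd_space X) (lyd_space Y)" "g \<in> lin_maps K (lyd_space Y) (lyd_space Z)"
    using f g by (simp_all add: defs)
  note lin' = lin[THEN lin_maps_linear]
  note fc = is_linear_closed[OF lin'(1)]
  have TA: "tensor_map K (lyd_space X) (lsys_A B) (lyd_space Y) (lsys_A B) f (id_on (lsys_A B)) t
      \<in> carrier (tensor_space K (lyd_space Y) (lsys_A B))"
    if "t \<in> carrier (tensor_space K (lyd_space X) (lsys_A B))" for t
    by (rule is_linear_closed[OF tensor_map_linear[OF ob(1)[OF X] A ob(1)[OF Y] A lin'(1) is_linear_id_on[OF A]] that])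
  show "Cmp ?C X Y Z g f \<in> Hom ?C X Z"
    using f g act coact fc TA lin_maps_compose[OF ob(1)[OF X] lin]
    by (simp add: defs tensor_map_compose[OF ob(1)[OF X] ob(1)[OF Y] ob(1)[OF Z] A lin']
      tensor_map_compose[OF ob(1)[OF X] ob(1)[OF Y] ob(1)[OF Z] C lin'] compose_eq)
next
  let ?C = "YD_Lin K B :: (('k, 'v, 'a, 'c) lin_yd, 'v \<Rightarrow> 'v) cat"
  fix W X Y Z f g h
  assume "f \<in> Hom ?C W X"
  then have "f \<in> carrier (lyd_space W) \<rightarrow> carrier (lyd_space X)"
    by (auto simp: YD_Lin_def lin_yd_hom_def Let_def lin_maps_def)
  then show "Cmp ?C W X Z (Cmp ?C X Y Z h g) f = Cmp ?C W Y Z h (Cmp ?C W X Y g f)"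
    by (simp add: YD_Lin_def compose_assoc)
qed

lemma lin_rep_inclusion:
  fixes K :: "('k, 'i) ring_scheme"
  assumes K: "cring K" and S: "shelf S opS" and dot: "\<And>r s. r \<in> R \<Longrightarrow> s \<in> S \<Longrightarrow> dot r s \<in> R"
  shows "category_inclusion
     (M_Lin K R S opS dot :: (('k, 'v, 'r, 's) lin_rep, 'v \<Rightarrow> 'v) cat)
     (YD_Lin K (linearize_system K (cm_system R S opS dot)))
     (lin_rep_to_yd K R S) (\<lambda>M N f. f)"
proof -
  let ?B = "linearize_system K (cm_system R S opS dot)"
  let ?M = "M_Lin K R S opS dot :: (('k, 'v, 'r, 's) lin_rep, 'v \<Rightarrow> 'v) cat"
  have C: "category ?M" by (rule M_Lin_category[OF dot])
  have D: "category (YD_Lin K ?B :: (('k, 'v, 's \<Rightarrow> 'k, 'r \<Rightarrow> 'k) lin_yd, 'v \<Rightarrow> 'v) cat)"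
    by (rule YD_Lin_category) (simp_all add: linearize_system_def cm_system_def free_space_module[OF K])
  have ctx: "linear_representation K R S opS dot X" if "X \<in> Ob ?M" for X
    using that K S dot by (simp add: M_Lin_def linear_representation_def)
  have obj: "lin_rep_to_yd K R S X \<in> Ob (YD_Lin K ?B)" if "X \<in> Ob ?M" for X
    using linear_representation.yd_object[OF ctx[OF that]] by (simp add: YD_Lin_def)
  have hom: "Hom (YD_Lin K ?B) (lin_rep_to_yd K R S X) (lin_rep_to_yd K R S Y) = Hom ?M X Y"
    if "X \<in> Ob ?M" "Y \<in> Ob ?M" for X Y
    using lin_rep_to_yd_hom[OF ctx[OF that(1)] ctx[OF that(2)]] by (simp add: YD_Lin_def M_Lin_def)
  have space: "lyd_space (lin_rep_to_yd K R S X) = lrep_space X" for X :: "('k, 'v, 'r, 's) lin_rep"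
    by (simp add: lin_rep_to_yd_def Let_def)
  show ?thesis
  proof (intro category_inclusion.intro category_functor.intro C D category_functor_axioms.intro
        category_inclusion_axioms.intro)
    show "inj_on (lin_rep_to_yd K R S) (Ob ?M)"
      using lin_rep_to_yd_inj[OF ctx ctx] by (auto intro: inj_onI)
  qed (use obj hom in \<open>auto simp: M_Lin_def YD_Lin_def space\<close>)
qed

theorem proposition3p16:
  fixes R :: "'r set" and opR :: "'r \<Rightarrow> 'r \<Rightarrow> 'r"
    and S :: "'s set" and opS :: "'s \<Rightarrow> 's \<Rightarrow> 's"
    and dot :: "'r \<Rightarrow> 's \<Rightarrow> 'r" and \<pi> :: "'r \<Rightarrow> 's"
    and K :: "('k, 'i) ring_scheme"
  assumes "crossed_module_of_shelves R opR S opS dot \<pi>"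
    and "field K"
  shows "category_inclusion
           (M_Set R S opS dot :: (('m, 'r, 's) set_rep, 'm \<Rightarrow> 'm) cat)
           (YD_Set (cm_system R S opS dot))
           (set_rep_to_yd S)
           (\<lambda>M N f. f) \<and>
         category_inclusion
           (M_Lin K R S opS dot :: (('k, 'v, 'r, 's) lin_rep, 'v \<Rightarrow> 'v) cat)
           (YD_Lin K (linearize_system K (cm_system R S opS dot)))
           (lin_rep_to_yd K R S)
           (\<lambda>M N f. f)"
proof
  interpret crossed_module_of_shelves R opR S opS dot \<pi> by fact
  interpret K: field K by fact
  show "category_inclusion
           (M_Set R S opS dot :: (('m, 'r, 's) set_rep, 'm \<Rightarrow> 'm) cat)
           (YD_Set (cm_system R S opS dot)) (set_rep_to_yd S) (\<lambda>M N f. f)"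
    by (rule set_rep_inclusion) fact
  show "category_inclusion
           (M_Lin K R S opS dot :: (('k, 'v, 'r, 's) lin_rep, 'v \<Rightarrow> 'v) cat)
           (YD_Lin K (linearize_system K (cm_system R S opS dot)))
           (lin_rep_to_yd K R S) (\<lambda>M N f. f)"
    by (rule lin_rep_inclusion[OF K.is_cring S.shelf_axioms dot.act_closed])
qed

end
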